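(* The value function $V:[0,1]^n\to[0,\infty)$, $$V(\pi)=\inf_{\tau}\mathbb{E}_{\pi}\left[g(\Pi_{\tau})+\int_0^{\tau}h(\Pi_s)\,ds\right],$$ is concave in each variable separately; that is, for each $i=1,\dots,n$ and each fixed choice of the coordinates $\pi_j\in[0,1]$, $j\neq i$, the function $\pi_i\mapsto V(\pi_1,\dots,\pi_n)$ is concave on $[0,1]$.
   Context: Let $n\ge 1$ and let $\mu_i>0$, $\lambda_i\ge 0$ ($i=1,\dots,n$) be known constants. For $\pi=(\pi_1,\dots,\pi_n)\in[0,1]^n$ let $\mathbb P_\pi$ (with expectation $\mathbb E_\pi$) be a probability measure under which: $Y^1,\dots,Y^n$ are continuous-time Markov chains with state space $\{0,1\}$, $Y^i$ having transition rate matrix $\begin{pmatrix}-\lambda_i&\lambda_i\\0&0\end{pmatrix}$ and $\mathbb P_\pi(Y^i_0=1)=\pi_i$; $W^1,\dots,W^n$ are one-dimensional standard Brownian motions; and $Y^1,\dots,Y^n,W^1,\dots,W^n$ are independent. The observation process $X=(X^1,\dots,X^n)$ is given by $dX^i_t=\mu_iY^i_t\,dt+dW^i_t$, $X^i_0=0$, and $\mathcal F^X=(\mathcal F^X_t)_{t\ge0}$ is the filtration it generates. The posterior probability process $\Pi=(\Pi^1,\dots,\Pi^n)$ is $\Pi^i_t=\mathbb E_\pi[Y^i_t\mid\mathcal F^X_t]$ (continuous version); it satisfies $\Pi_0=\pi$ and $$d\Pi^i_t=\lambda_i(1-\Pi^i_t)\,dt+\mu_i\Pi^i_t(1-\Pi^i_t)\,d\bar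 W^i_t,\qquad \bar W^i_t=X^i_t-\mu_i\int_0^t\Pi^i_s\,ds,$$ where $\bar W=(\bar W^1,\dots,\bar W^n)$ is an $n$-dimensional $\mathcal F^X$-Brownian motion with independent coordinates. The infimum defining $V$ is over ($\mathbb P_\pi$-a.s. finite) $\mathcal F^X$-stopping times $\tau$. Standing assumptions on $g,h:[0,1]^n\to[0,\infty)$: $g$ and $h$ are Lipschitz continuous; $g(\pi)$ and $h(\pi)$ are concave in each variable $\pi_i$ separately; if $\lambda_i=0$ for some $i\in\{1,\dots,n\}$, then $h$ is constant. *)

theory Defs
  imports "HOL-Probability.Probability"
begin

(* Index set [0, \<infinity>] (type ennreal), so that the stopping_time of HOL-Probability, instantiated
   with this filtration, may take the value \<infinity>. The processes are indexed by real times and only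
   their values at times s \<ge> 0 are used. No null sets are added. *)
definition natural_filtration ::
    "'a set \<Rightarrow> (real \<Rightarrow> 'a \<Rightarrow> 'b::topological_space) \<Rightarrow> ennreal \<Rightarrow> 'a measure" where
  "natural_filtration \<Omega> Z t =
     sigma \<Omega> {Z s -` A \<inter> \<Omega> | s A. 0 \<le> s \<and> ennreal s \<le> t \<and> A \<in> sets borel}"

primrec matrix_power :: "'s set \<Rightarrow> ('s \<Rightarrow> 's \<Rightarrow> real) \<Rightarrow> nat \<Rightarrow> 's \<Rightarrow> 's \<Rightarrow> real" where
  "matrix_power S Q 0 x y = of_bool (x = y)"
| "matrix_power S Q (Suc k) x y = (\<Sum>z\<in>S. Q x z * matrix_power S Q k z y)"

(* Entries of the matrix exponential exp (t Q). *)
definition transition_prob :: "'s set \<Rightarrow> ('s \<Rightarrow> 's \<Rightarrow> real) \<Rightarrow> real \<Rightarrow> 's \<Rightarrow> 's \<Rightarrow> real" where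
  "transition_prob S Q t x y = (\<Sum>k. t ^ k / fact k * matrix_power S Q k x y)"

(* Time-homogeneous Markov chain (with respect to its own filtration) on a finite set S of reals,
   with transition semigroup exp (t Q) and almost surely right-continuous paths. *)
definition markov_chain ::
    "'a measure \<Rightarrow> real set \<Rightarrow> (real \<Rightarrow> real \<Rightarrow> real) \<Rightarrow> (real \<Rightarrow> 'a \<Rightarrow> real) \<Rightarrow> bool" where
  "markov_chain M S Q Y \<longleftrightarrow>
     finite S \<and>
     (\<forall>t\<ge>0. Y t \<in> borel_measurable M \<and> (\<forall>\<omega>\<in>space M. Y t \<omega> \<in> S)) \<and>
     (AE \<omega> in M. \<forall>t\<ge>0. continuous (at_right t) (\<lambda>s. Y s \<omega>)) \<and>
     (\<forall>s t. 0 \<le> s \<longrightarrow> s \<le> t \<longrightarrow> (\<forall>y\<in>S. AE \<omega> in M.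
        real_cond_exp M (natural_filtration (space M) Y (ennreal s))
          (indicator {\<omega>\<in>space M. Y t \<omega> = y}) \<omega> = transition_prob S Q (t - s) (Y s \<omega>) y))"

(* Quantifying over infinite monotone sequences of times covers all finite partitions. *)
definition brownian_motion :: "'a measure \<Rightarrow> (real \<Rightarrow> 'a \<Rightarrow> real) \<Rightarrow> bool" where
  "brownian_motion M W \<longleftrightarrow>
     (\<forall>t\<ge>0. W t \<in> borel_measurable M) \<and>
     (AE \<omega> in M. W 0 \<omega> = 0) \<and>
     (AE \<omega> in M. continuous_on {0..} (\<lambda>t. W t \<omega>)) \<and>
     (\<forall>s t. 0 \<le> s \<longrightarrow> s < t \<longrightarrow>
        distributed M lborel (\<lambda>\<omega>. W t \<omega> - W s \<omega>) (normal_density 0 (sqrt (t - s)))) \<and>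
     (\<forall>r::nat \<Rightarrow> real. 0 \<le> r 0 \<longrightarrow> mono r \<longrightarrow>
        prob_space.indep_vars M (\<lambda>_. borel) (\<lambda>k \<omega>. W (r (Suc k)) \<omega> - W (r k) \<omega>) UNIV)"

(* The rate matrix with rows (-l, l) and (0, 0) on the states 0, 1. *)
definition rate_matrix :: "real \<Rightarrow> real \<Rightarrow> real \<Rightarrow> real" where
  "rate_matrix l x y = (if x = 0 then (if y = 0 then - l else l) else 0)"

(* M plays the role of the probability space with measure P_\<pi>. The 2n processes are independent
   as random elements of the path space, indexed by the disjoint sum of two copies of 'n. *)
definition observation_model ::
    "('n::finite \<Rightarrow> real) \<Rightarrow> ('n \<Rightarrow> real) \<Rightarrow> real^'n \<Rightarrow> 'a measure \<Rightarrow>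
     ('n \<Rightarrow> real \<Rightarrow> 'a \<Rightarrow> real) \<Rightarrow> ('n \<Rightarrow> real \<Rightarrow> 'a \<Rightarrow> real) \<Rightarrow> (real \<Rightarrow> 'a \<Rightarrow> real^'n) \<Rightarrow> bool" where
  "observation_model \<mu> lam \<pi> M Y W X \<longleftrightarrow>
     prob_space M \<and>
     (\<forall>i. markov_chain M {0, 1} (rate_matrix (lam i)) (Y i)) \<and>
     (\<forall>i. measure M {\<omega>\<in>space M. Y i 0 \<omega> = 1} = \<pi> $ i) \<and>
     (\<forall>i. brownian_motion M (W i)) \<and>
     prob_space.indep_vars M (\<lambda>_. PiM {0..} (\<lambda>_. borel))
       (case_sum (\<lambda>i \<omega>. \<lambda>t\<in>{0..}. Y i t \<omega>) (\<lambda>i \<omega>. \<lambda>t\<in>{0..}. W i t \<omega>)) (UNIV :: ('n + 'n) set) \<and>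
     (\<forall>t\<ge>0. X t \<in> borel_measurable M) \<and>
     (AE \<omega> in M. \<forall>t\<ge>0. \<forall>i.
        X t \<omega> $ i = \<mu> i * (LINT s:{0..t}|lborel. Y i s \<omega>) + W i t \<omega>)"

definition posterior_process ::
    "'a measure \<Rightarrow> ('n::finite \<Rightarrow> real \<Rightarrow> 'a \<Rightarrow> real) \<Rightarrow> (real \<Rightarrow> 'a \<Rightarrow> real^'n) \<Rightarrow>
     (real \<Rightarrow> 'a \<Rightarrow> real^'n) \<Rightarrow> bool" where
  "posterior_process M Y X Post \<longleftrightarrow>
     (\<forall>t\<ge>0. Post t \<in> borel_measurable M) \<and>
     (AE \<omega> in M. continuous_on {0..} (\<lambda>t. Post t \<omega>)) \<and>
     (\<forall>t\<ge>0. \<forall>i. AE \<omega> in M.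
        Post t \<omega> $ i = real_cond_exp M (natural_filtration (space M) X (ennreal t)) (Y i t) \<omega>)"

definition unit_cube :: "(real^'n) set" where
  "unit_cube = {\<pi>. \<forall>i. 0 \<le> \<pi> $ i \<and> \<pi> $ i \<le> 1}"

definition concave_in_each_variable :: "(real^'n \<Rightarrow> real) \<Rightarrow> bool" where
  "concave_in_each_variable f \<longleftrightarrow>
     (\<forall>i. \<forall>\<pi>\<in>unit_cube. concave_on {0..1} (\<lambda>x. f (\<chi> j. if j = i then x else \<pi> $ j)))"

definition admissible_times ::
    "'a measure \<Rightarrow> (real \<Rightarrow> 'a \<Rightarrow> real^'n::finite) \<Rightarrow> ('a \<Rightarrow> ennreal) set" where
  "admissible_times M X =
     {\<tau>. stopping_time (natural_filtration (space M) X) \<tau> \<and> (AE \<omega> in M. \<tau> \<omega> < \<infinity>)}"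

(* Expectations of nonnegative quantities are taken in [0, \<infinity>], since the running cost may have
   infinite expectation for some stopping times. *)
definition expected_cost ::
    "'a measure \<Rightarrow> (real \<Rightarrow> 'a \<Rightarrow> real^'n::finite) \<Rightarrow> (real^'n \<Rightarrow> real) \<Rightarrow> (real^'n \<Rightarrow> real) \<Rightarrow>
     ('a \<Rightarrow> ennreal) \<Rightarrow> ennreal" where
  "expected_cost M Post g h \<tau> =
     (\<integral>\<^sup>+\<omega>. (ennreal (g (Post (enn2real (\<tau> \<omega>)) \<omega>)) +
            (\<integral>\<^sup>+s\<in>{s. 0 \<le> s \<and> ennreal s \<le> \<tau> \<omega>}. ennreal (h (Post s \<omega>)) \<partial>lborel)) \<partial>M)"

definition value_function ::
    "(real^'n \<Rightarrow> 'a measure) \<Rightarrow> (real \<Rightarrow> 'a \<Rightarrow> real^'n) \<Rightarrow> (real^'n \<Rightarrow> real \<Rightarrow> 'a \<Rightarrow> real^'n::finite) \<Rightarrow>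
     (real^'n \<Rightarrow> real) \<Rightarrow> (real^'n \<Rightarrow> real) \<Rightarrow> real^'n \<Rightarrow> ennreal" where
  "value_function P X Post g h \<pi> =
     (INF \<tau>\<in>admissible_times (P \<pi>) X. expected_cost (P \<pi>) (Post \<pi>) g h \<tau>)"

end

theory Submission
  imports Defs
begin

text \<open>Fix a stopping time and vary only the prior \<open>\<pi>\<^sub>i\<close>. By independence the law of all observations
  and signals is affine in \<open>\<pi>\<^sub>i\<close>, and the posteriors of the other coordinates do not depend on
  \<open>\<pi>\<^sub>i\<close>. If \<open>P = (1 - a) Q + a R\<close> on the observation sigma-algebra, the \<open>i\<close>-th posterior under \<open>P\<close> is
  the average of those under \<open>Q\<close> and \<open>R\<close> with random weights \<open>D\<close> and \<open>1 - D\<close>, where \<open>D\<close> is the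
  density of \<open>(1 - a) Q\<close> with respect to \<open>P\<close>. Applying the concavity of a cost function pointwise and
  integrating shows that its expectation at a fixed time, on an event observable by then, is concave
  in \<open>\<pi>\<^sub>i\<close>. Discretising the stopping time for the terminal cost and using Tonelli's theorem for
  the running cost, the expected cost of the stopping time is concave in \<open>\<pi>\<^sub>i\<close>, and so is the infimum.\<close>

section \<open>Mixtures of probability measures\<close>

text \<open>The measures of different priors share a sigma-algebra and prescribed laws of the
  processes, but are otherwise arbitrary. A mixture identity can therefore be expected only on
  events generated by \<open>X\<close> and \<open>Y\<close>, which is why \<open>mixture_on\<close>
  carries a collection of sets. The paths of \<open>Y\<close> have to be included because a
  posterior depends on the joint law of signal and observation. The filtration of \<open>X\<close>
  is raw and does not involve the prior, so one function \<open>\<tau>\<close> is a stopping time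
  under all three measures at once. \<open>Post\<close> is a different process for each prior,
  identified as a conditional expectation only at each fixed time and up to null sets of its own
  measure. Concavity is therefore proved first at deterministic times, with the posteriors replaced
  by observable versions clipped to the cube. Rounding a stopping time up, not down, keeps each
  event of the rounding observable at its grid time; almost sure continuity of the posterior then
  gives the limit.\<close>

definition mixture_on :: "real \<Rightarrow> 'a measure \<Rightarrow> 'a measure \<Rightarrow> 'a measure \<Rightarrow> 'a set set \<Rightarrow> bool" where
  "mixture_on a P Q R \<A> \<longleftrightarrow> (\<forall>E\<in>\<A>. measure P E = (1 - a) * measure Q E + a * measure R E)"

lemma mixture_onI:
  "(\<And>E. E \<in> \<A> \<Longrightarrow> measure P E = (1 - a) * measure Q E + a * measure R E) \<Longrightarrow> mixture_on a P Q R \<A>"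
  by (simp add: mixture_on_def)

lemma mixture_onD:
  "mixture_on a P Q R \<A> \<Longrightarrow> E \<in> \<A> \<Longrightarrow> measure P E = (1 - a) * measure Q E + a * measure R E"
  by (simp add: mixture_on_def)

text \<open>A pi-lambda argument: the identity passes to complements because the weights
  \<open>1 - a\<close> and \<open>a\<close> add up to the total mass \<open>1\<close>, and to
  countable disjoint unions because series add termwise.\<close>

lemma mixture_on_sigma_sets:
  assumes "prob_space P" "prob_space Q" "prob_space R"
    and sets: "sets Q = sets P" "sets R = sets P"
    and \<G>: "\<G> \<subseteq> sets P" "Int_stable \<G>"
    and mix: "mixture_on a P Q R \<G>"
  shows "mixture_on a P Q R (sigma_sets (space P) \<G>)"
proof (rule mixture_onI)
  interpret P: prob_space P by fact
  interpret Q: prob_space Q by fact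
  interpret R: prob_space R by fact
  have sp: "space Q = space P" "space R = space P"
    using sets by (auto dest: sets_eq_imp_space_eq)
  have sub: "sigma_sets (space P) \<G> \<subseteq> sets P"
    using \<G> by (simp add: sets.sigma_sets_subset)
  fix E assume "E \<in> sigma_sets (space P) \<G>"
  from \<G>(2) order_trans[OF \<G>(1) sets.space_closed] this
  show "measure P E = (1 - a) * measure Q E + a * measure R E"
  proof (induct rule: sigma_sets_induct_disjoint)
    case (basic A)
    then show ?case using mix by (rule mixture_onD[rotated])
  next
    case empty
    show ?case by simp
  next
    case (compl A)
    have "A \<in> sets P" using compl(1) sub by auto
    then have diff: "measure P (space P - A) = 1 - measure P A"
      "measure Q (space P - A) = 1 - measure Q A" "measure R (space P - A) = 1 - measure R A"
      using P.prob_compl[of A] Q.prob_compl[of A] R.prob_compl[of A] sets sp by auto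
    show ?case
      unfolding diff compl(2) by (simp add: algebra_simps)
  next
    case (union A)
    have A': "range A \<subseteq> sets P" using union(2) sub by auto
    have "(\<lambda>i. measure P (A i)) sums measure P (\<Union>i. A i)"
      by (rule P.finite_measure_UNION[OF A' union(1)])
    moreover have "(\<lambda>i. (1 - a) * measure Q (A i) + a * measure R (A i)) sums
        ((1 - a) * measure Q (\<Union>i. A i) + a * measure R (\<Union>i. A i))"
      using A' sets union(1)
      by (intro sums_add sums_mult Q.finite_measure_UNION R.finite_measure_UNION) auto
    ultimately show ?case
      unfolding union(3) by (rule sums_unique2)
  qed
qed

text \<open>The cylinders over finitely many coordinates form an intersection-stable generator of
  the product sigma-algebra, so finite-dimensional distributions decide.\<close>

lemma mixture_on_distr_PiM:
  assumes prob: "prob_space P" "prob_space Q" "prob_space R"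
    and sets: "sets Q = sets P" "sets R = sets P"
    and f: "f \<in> measurable P (PiM I N)"
    and cyl: "\<And>J A. finite J \<Longrightarrow> J \<subseteq> I \<Longrightarrow> (\<And>j. j \<in> J \<Longrightarrow> A j \<in> sets (N j)) \<Longrightarrow>
      measure P {\<omega>\<in>space P. \<forall>j\<in>J. f \<omega> j \<in> A j} =
      (1 - a) * measure Q {\<omega>\<in>space P. \<forall>j\<in>J. f \<omega> j \<in> A j} +
      a * measure R {\<omega>\<in>space P. \<forall>j\<in>J. f \<omega> j \<in> A j}"
  shows "mixture_on a (distr P (PiM I N) f) (distr Q (PiM I N) f) (distr R (PiM I N) f)
    (sets (PiM I N))"
proof -
  have sp: "space Q = space P" "space R = space P"
    using sets by (auto dest: sets_eq_imp_space_eq)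
  have fQ: "f \<in> measurable Q (PiM I N)" and fR: "f \<in> measurable R (PiM I N)"
    using f sets by (auto simp: measurable_def sp)
  have "mixture_on a (distr P (PiM I N) f) (distr Q (PiM I N) f) (distr R (PiM I N) f)
    (sigma_sets (space (distr P (PiM I N) f)) (prod_algebra I N))"
  proof (rule mixture_on_sigma_sets)
    show "prod_algebra I N \<subseteq> sets (distr P (PiM I N) f)"
      by (simp add: sets_PiM) blast
    show "mixture_on a (distr P (PiM I N) f) (distr Q (PiM I N) f) (distr R (PiM I N) f)
      (prod_algebra I N)"
    proof (rule mixture_onI)
      fix E assume E: "E \<in> prod_algebra I N"
      then have Es: "E \<in> sets (PiM I N)" by (simp add: sets_PiM sigma_sets.Basic)
      from prod_algebraE[OF E] obtain J A where J: "E = prod_emb I N J (Pi\<^sub>E J A)" "finite J"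
        "J \<subseteq> I" "\<And>i. i \<in> J \<Longrightarrow> A i \<in> sets (N i)" by metis
      have "f \<omega> \<in> E \<longleftrightarrow> (\<forall>j\<in>J. f \<omega> j \<in> A j)" if "\<omega> \<in> space P" for \<omega>
        using measurable_space[OF f that] by (simp add: J(1) prod_emb_def space_PiM PiE_iff)
      then have "f -` E \<inter> space P = {\<omega>\<in>space P. \<forall>j\<in>J. f \<omega> j \<in> A j}" by auto
      then show "measure (distr P (PiM I N) f) E =
          (1 - a) * measure (distr Q (PiM I N) f) E + a * measure (distr R (PiM I N) f) E"
        using cyl[OF J(2,3,4)] Es f fQ fR by (simp add: measure_distr sp)
    qed
  qed (use prob f fQ fR in \<open>auto intro!: prob_space.prob_space_distr Int_stable_prod_algebra\<close>)
  then show ?thesis by (simp add: sets_PiM space_PiM)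
qed

text \<open>With a finite index set every cylinder is a full rectangle: the unconstrained factors
  are filled with the whole space.\<close>

lemma mixture_on_distr_PiM_finite:
  assumes prob: "prob_space P" "prob_space Q" "prob_space R"
    and sets: "sets Q = sets P" "sets R = sets P"
    and f: "f \<in> measurable P (PiM I N)" and I: "finite I"
    and cyl: "\<And>A. (\<And>j. j \<in> I \<Longrightarrow> A j \<in> sets (N j)) \<Longrightarrow>
      measure P {\<omega>\<in>space P. \<forall>j\<in>I. f \<omega> j \<in> A j} =
      (1 - a) * measure Q {\<omega>\<in>space P. \<forall>j\<in>I. f \<omega> j \<in> A j} +
      a * measure R {\<omega>\<in>space P. \<forall>j\<in>I. f \<omega> j \<in> A j}"
  shows "mixture_on a (distr P (PiM I N) f) (distr Q (PiM I N) f) (distr R (PiM I N) f)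
    (sets (PiM I N))"
proof (rule mixture_on_distr_PiM[OF prob sets f])
  fix J A assume J: "finite J" "J \<subseteq> I" "\<And>j. j \<in> J \<Longrightarrow> A j \<in> sets (N j)"
  define B where "B j = (if j \<in> J then A j else space (N j))" for j
  have "{\<omega>\<in>space P. \<forall>j\<in>J. f \<omega> j \<in> A j} = {\<omega>\<in>space P. \<forall>j\<in>I. f \<omega> j \<in> B j}"
    using J(2) measurable_space[OF f] by (auto simp: B_def space_PiM PiE_iff)
  moreover have "B j \<in> sets (N j)" if "j \<in> I" for j
    using J by (auto simp: B_def)
  ultimately show "measure P {\<omega>\<in>space P. \<forall>j\<in>J. f \<omega> j \<in> A j} =
      (1 - a) * measure Q {\<omega>\<in>space P. \<forall>j\<in>J. f \<omega> j \<in> A j} +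
      a * measure R {\<omega>\<in>space P. \<forall>j\<in>J. f \<omega> j \<in> A j}"
    using cyl[of B] by simp
qed

section \<open>Paths recovered from their values on a grid\<close>

text \<open>Rounding up with the ceiling makes the grid points approach \<open>s\<close> from the
  right at distance at most \<open>1 / Suc k\<close>, which is why right-continuity
  suffices.\<close>

lemma tendsto_right_discretisation:
  fixes f :: "real \<Rightarrow> 'b::t2_space"
  assumes "0 \<le> s" "continuous (at_right s) f"
  shows "(\<lambda>k. f (real (nat \<lceil>s * Suc k\<rceil>) / Suc k)) \<longlonglongrightarrow> f s"
proof -
  let ?x = "\<lambda>k. real (nat \<lceil>s * Suc k\<rceil>) / Suc k"
  have eq: "real (nat \<lceil>s * Suc k\<rceil>) = of_int \<lceil>s * Suc k\<rceil>" for k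
    using assms(1) by (simp add: of_nat_nat)
  have lb: "s \<le> ?x k" for k
    unfolding eq by (simp add: pos_le_divide_eq)
  have ub: "?x k \<le> s + 1 / Suc k" for k
  proof -
    have "of_int \<lceil>s * Suc k\<rceil> \<le> s * Suc k + 1" by linarith
    then show ?thesis unfolding eq by (simp add: pos_divide_le_eq distrib_right)
  qed
  have "?x \<longlonglongrightarrow> s"
  proof (rule tendsto_sandwich[OF _ _ tendsto_const])
    show "(\<lambda>k. s + 1 / real (Suc k)) \<longlonglongrightarrow> s"
      using tendsto_add[OF tendsto_const LIMSEQ_inverse_real_of_nat, of s] by (simp add: inverse_eq_divide)
  qed (simp_all only: lb ub eventually_sequentially, auto)
  \<comment> \<open>The closed half-line gives the same filter as \<open>at_right s\<close>, and it
    matches the bound \<open>lb\<close>: grid points may coincide with \<open>s\<close>.\<close>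
  moreover have "continuous (at s within {s..}) f"
  proof -
    have "at s within {s..} = at_right s"
      by (rule at_within_nhd[of s UNIV]) auto
    then show ?thesis using assms(2) by simp
  qed
  ultimately show ?thesis
    by (rule continuous_within_tendsto_compose'[rotated 2]) (simp only: atLeast_iff lb)
qed

text \<open>Joint measurability in sample point and time comes from the countable range of the
  rounded time, then from a pointwise limit. \<open>lim\<close> is total, so the limit is measurable
  even where the sequence diverges.\<close>

lemma measurable_right_discretisation:
  fixes f :: "real \<Rightarrow> 'a \<Rightarrow> 'b::{banach, second_countable_topology}"
  assumes "\<And>t. 0 \<le> t \<Longrightarrow> f t \<in> borel_measurable N"
  shows "(\<lambda>(\<omega>, s). lim (\<lambda>k. f (real (nat \<lceil>s * Suc k\<rceil>) / Suc k) \<omega>)) \<in> borel_measurable (N \<Otimes>\<^sub>M lborel)"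
proof -
  have [measurable]: "f (real i / Suc k) \<in> borel_measurable N" for i k
    using assms by simp
  have "(\<lambda>x. lim (\<lambda>k. (\<lambda>i. f (real i / Suc k) (fst x)) (nat \<lceil>snd x * Suc k\<rceil>)))
      \<in> borel_measurable (N \<Otimes>\<^sub>M lborel)"
  proof (rule borel_measurable_lim_metric)
    fix k
    show "(\<lambda>x. (\<lambda>i. f (real i / Suc k) (fst x)) (nat \<lceil>snd x * Suc k\<rceil>)) \<in> borel_measurable (N \<Otimes>\<^sub>M lborel)"
      by (rule measurable_compose_countable) measurable
  qed
  then show ?thesis by (simp add: case_prod_unfold)
qed

section \<open>Laws of the driving processes\<close>

lemma space_natural_filtration[simp]: "space (natural_filtration \<Omega> Z t) = \<Omega>"
  unfolding natural_filtration_def by (rule space_measure_of) auto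

lemma measurable_natural_filtration:
  assumes "0 \<le> s" "ennreal s \<le> t"
  shows "Z s \<in> borel_measurable (natural_filtration \<Omega> Z t)"
proof (rule measurableI)
  fix A :: "'b set" assume "A \<in> sets borel"
  then have "Z s -` A \<inter> \<Omega> \<in> {Z s -` A \<inter> \<Omega> | s A. 0 \<le> s \<and> ennreal s \<le> t \<and> A \<in> sets borel}"
    using assms by auto
  then show "Z s -` A \<inter> space (natural_filtration \<Omega> Z t) \<in> sets (natural_filtration \<Omega> Z t)"
    unfolding natural_filtration_def by (subst space_measure_of) auto
qed simp

lemma subalgebra_natural_filtration:
  assumes "\<And>s. 0 \<le> s \<Longrightarrow> Z s \<in> borel_measurable M"
  shows "subalgebra M (natural_filtration (space M) Z t)"
proof -
  have "sets (natural_filtration (space M) Z t) \<subseteq> sets M"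
    unfolding natural_filtration_def
  proof (subst sets_measure_of)
    show "sigma_sets (space M) {Z s -` A \<inter> space M |s A. 0 \<le> s \<and> ennreal s \<le> t \<and> A \<in> sets borel}
        \<subseteq> sets M"
      using assms by (intro sets.sigma_sets_subset) (auto intro: measurable_sets)
  qed auto
  then show ?thesis by (simp add: subalgebra_def)
qed

lemma sets_cylinder:
  assumes "finite J" "\<And>j. j \<in> J \<Longrightarrow> Z j \<in> measurable M (N j)" "\<And>j. j \<in> J \<Longrightarrow> A j \<in> sets (N j)"
  shows "{\<omega>\<in>space M. \<forall>j\<in>J. Z j \<omega> \<in> A j} \<in> sets M"
proof (rule sets.sets_Collect_finite_All)
  fix j assume j: "j \<in> J"
  have "Z j -` A j \<inter> space M \<in> sets M"
    using assms(2,3)[OF j] by (rule measurable_sets)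
  moreover have "Z j -` A j \<inter> space M = {\<omega>\<in>space M. Z j \<omega> \<in> A j}" by blast
  ultimately show "{\<omega>\<in>space M. Z j \<omega> \<in> A j} \<in> sets M" by simp
qed fact

section \<open>The path law of Brownian motion is unique\<close>

text \<open>Independent increments have a product law whose factors depend on the times alone, so
  both measures yield the same product.\<close>

lemma brownian_increments_distr_eq:
  assumes "prob_space P" "prob_space Q" "brownian_motion P W" "brownian_motion Q W"
    and r: "0 \<le> r 0" "mono r"
  shows "distr P (PiM UNIV (\<lambda>_. borel)) (\<lambda>\<omega>. \<lambda>k\<in>UNIV. W (r (Suc k)) \<omega> - W (r k) \<omega>) =
    distr Q (PiM UNIV (\<lambda>_. borel)) (\<lambda>\<omega>. \<lambda>k\<in>UNIV. W (r (Suc k)) \<omega> - W (r k) \<omega>)"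
proof -
  let ?\<Delta> = "\<lambda>k \<omega>. W (r (Suc k)) \<omega> - W (r k) \<omega>"
  have pos: "0 \<le> r k" for k using r monoD[of r 0 k] by simp
  \<comment> \<open>The times need not increase strictly. A repeated time gives a zero increment
    with Dirac law, a case outside the Gaussian clause of \<open>brownian_motion\<close>.\<close>
  have *: "distr M (PiM UNIV (\<lambda>_. borel)) (\<lambda>\<omega>. \<lambda>k\<in>UNIV. ?\<Delta> k \<omega>) = PiM UNIV (\<lambda>k.
      if r k < r (Suc k) then density lborel (normal_density 0 (sqrt (r (Suc k) - r k))) else return borel 0)"
    if M: "prob_space M" "brownian_motion M W" for M
  proof -
    interpret prob_space M by fact
    have rv: "?\<Delta> k \<in> borel_measurable M" for k
      using M(2) pos by (auto simp: brownian_motion_def intro!: borel_measurable_diff)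
    have "distr M borel (?\<Delta> k) = (if r k < r (Suc k)
      then density lborel (normal_density 0 (sqrt (r (Suc k) - r k))) else return borel 0)" for k
    proof (cases "r k < r (Suc k)")
      case True
      then have "distributed M lborel (?\<Delta> k) (normal_density 0 (sqrt (r (Suc k) - r k)))"
        using M(2) pos unfolding brownian_motion_def by blast
      then have "distr M lborel (?\<Delta> k) = density lborel (normal_density 0 (sqrt (r (Suc k) - r k)))"
        by (simp add: distributed_def)
      moreover have "distr M lborel (?\<Delta> k) = distr M borel (?\<Delta> k)"
        by (rule distr_cong) auto
      ultimately show ?thesis using True by simp
    next
      case False
      then have "r (Suc k) = r k" using r(2) by (meson incseq_SucD not_less order_antisym)
      then show ?thesis by simp
    qed
    moreover have "indep_vars (\<lambda>_. borel) ?\<Delta> UNIV"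
      using M(2) r unfolding brownian_motion_def by blast
    ultimately show ?thesis
      using indep_vars_iff_distr_eq_PiM[where I=UNIV and M'="\<lambda>_. borel" and X="?\<Delta>"] rv by simp
  qed
  show ?thesis using *[OF assms(1,3)] *[OF assms(2,4)] by simp
qed

text \<open>Independence of increments is formulated along infinite monotone sequences, so finitely
  many times have to be embedded in one. Starting at \<open>0\<close> lets the partial sums of
  increments give the values of the path itself.\<close>

lemma finite_subset_range_mono:
  fixes J :: "real set"
  assumes "finite J" "J \<subseteq> {0..}"
  obtains r :: "nat \<Rightarrow> real" where "r 0 = 0" "mono r" "J \<subseteq> range r"
proof -
  define l where "l = sorted_list_of_set (insert 0 J)"
  have l: "set l = insert 0 J" "sorted l" using assms(1) unfolding l_def by (simp_all only: set_sorted_list_of_set finite_insert sorted_sorted_list_of_set)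
  then have ne: "l \<noteq> []" by auto
  \<comment> \<open>Once the sorted list is exhausted, the sequence stays at its last entry.\<close>
  define r where "r k = l ! min k (length l - 1)" for k
  have rng: "x \<in> range r" if x: "x \<in> set l" for x
  proof -
    obtain k where "k < length l" "l ! k = x" using x by (auto simp: in_set_conv_nth)
    then have "r k = x" by (simp add: r_def min_absorb1)
    then show ?thesis by auto
  qed
  have mono: "mono r"
    using ne l(2) unfolding r_def
    by (intro monoI sorted_nth_mono) (auto simp: min_def neq_Nil_conv)
  have "r 0 \<in> set l" using ne by (simp add: r_def)
  then have "0 \<le> r 0" using assms(2) l(1) by auto
  moreover have "r 0 \<le> 0"
  proof -
    obtain k where "r k = 0" using rng[of 0] l(1) by auto
    then show ?thesis using monoD[OF mono, of 0 k] by simp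
  qed
  ultimately show ?thesis using that mono rng l(1) by auto
qed

lemma measurable_path:
  assumes "\<And>t. 0 \<le> t \<Longrightarrow> Z t \<in> measurable M N"
  shows "(\<lambda>\<omega>. \<lambda>t\<in>{0..}. Z t \<omega>) \<in> measurable M (PiM {0::real..} (\<lambda>_. N))"
  using assms by (intro measurable_restrict) auto

lemma brownian_path_prob_eq:
  assumes P: "prob_space P" and Q: "prob_space Q" and sets: "sets Q = sets P"
    and BP: "brownian_motion P W" and BQ: "brownian_motion Q W"
    and E: "E \<in> sets (PiM {0..} (\<lambda>_. borel))"
  shows "measure P ((\<lambda>\<omega>. \<lambda>t\<in>{0..}. W t \<omega>) -` E \<inter> space P) =
    measure Q ((\<lambda>\<omega>. \<lambda>t\<in>{0..}. W t \<omega>) -` E \<inter> space P)"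
proof -
  let ?N = "PiM {0::real..} (\<lambda>_. borel :: real measure)" and ?f = "\<lambda>\<omega>. \<lambda>t\<in>{0::real..}. W t \<omega>"
  have sp: "space Q = space P" using sets by (rule sets_eq_imp_space_eq)
  have WP: "W t \<in> borel_measurable P" "W t \<in> borel_measurable Q" if "0 \<le> t" for t
    using that BP BQ by (auto simp: brownian_motion_def)
  have f: "?f \<in> measurable P ?N" "?f \<in> measurable Q ?N"
    using WP by (auto intro!: measurable_path)
  \<comment> \<open>Equality of two laws is the mixture identity with weight \<open>0\<close>;
    \<open>Q\<close> then fills both slots.\<close>
  have "mixture_on 0 (distr P ?N ?f) (distr Q ?N ?f) (distr Q ?N ?f) (sets ?N)"
  proof (rule mixture_on_distr_PiM[OF P Q Q sets sets f(1)])
    fix J :: "real set" and A :: "real \<Rightarrow> real set"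
    assume J: "finite J" "J \<subseteq> {0..}" and A: "\<And>j. j \<in> J \<Longrightarrow> A j \<in> sets borel"
    obtain r :: "nat \<Rightarrow> real" where r: "r 0 = 0" "mono r" "J \<subseteq> range r"
      by (rule finite_subset_range_mono[OF J])
    then obtain k where k: "\<And>j. j \<in> J \<Longrightarrow> r (k j) = j"
      by (metis f_inv_into_f subset_iff)
    have pos: "0 \<le> r k" for k using r monoD[of r 0 k] by simp
    let ?\<Delta> = "\<lambda>\<omega>. \<lambda>l\<in>(UNIV::nat set). W (r (Suc l)) \<omega> - W (r l) \<omega>"
    let ?\<Pi> = "PiM (UNIV::nat set) (\<lambda>_. borel :: real measure)"
    \<comment> \<open>The cylinder rewritten in terms of increments: \<open>W j\<close> is the
      telescoping sum of the first \<open>k j\<close> increments, up to the null set on which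
      \<open>W 0\<close> is not \<open>0\<close>.\<close>
    define B where "B = {x\<in>space ?\<Pi>. \<forall>j\<in>J. (\<Sum>l<k j. x l) \<in> A j}"
    have B: "B \<in> sets ?\<Pi>"
      unfolding B_def using J(1) A
      by (intro sets_cylinder[where N="\<lambda>_. borel" and Z="\<lambda>j x. \<Sum>l<k j. x l"] borel_measurable_sum) auto
    have *: "measure M {\<omega>\<in>space P. \<forall>j\<in>J. W j \<omega> \<in> A j} = measure (distr M ?\<Pi> ?\<Delta>) B"
      if M: "prob_space M" "sets M = sets P" "brownian_motion M W" for M
    proof -
      have spM: "space M = space P" using M(2) by (rule sets_eq_imp_space_eq)
      have W: "W t \<in> borel_measurable M" if "0 \<le> t" for t
        using M(3) that by (auto simp: brownian_motion_def)
      have \<Delta>: "?\<Delta> \<in> measurable M ?\<Pi>"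
        using pos W by (intro measurable_restrict borel_measurable_diff) auto
      have "measure M {\<omega>\<in>space P. \<forall>j\<in>J. W j \<omega> \<in> A j} = measure M (?\<Delta> -` B \<inter> space M)"
      proof (rule measure_eq_AE)
        have "AE \<omega> in M. W 0 \<omega> = 0" using M(3) by (simp add: brownian_motion_def)
        then show "AE \<omega> in M. \<omega> \<in> {\<omega>\<in>space P. \<forall>j\<in>J. W j \<omega> \<in> A j} \<longleftrightarrow> \<omega> \<in> ?\<Delta> -` B \<inter> space M"
        proof eventually_elim
          case (elim \<omega>)
          have "(\<Sum>l<k j. W (r (Suc l)) \<omega> - W (r l) \<omega>) = W j \<omega>" if "j \<in> J" for j
            using elim k[OF that] r(1) sum_lessThan_telescope[of "\<lambda>l. W (r l) \<omega>" "k j"] by simp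
          then show ?case by (auto simp: B_def space_PiM spM)
        qed
        show "{\<omega>\<in>space P. \<forall>j\<in>J. W j \<omega> \<in> A j} \<in> sets M"
          unfolding spM[symmetric] using J A W by (intro sets_cylinder[where N="\<lambda>_. borel"]) auto
        show "?\<Delta> -` B \<inter> space M \<in> sets M" using \<Delta> B by (rule measurable_sets)
      qed
      then show ?thesis using \<Delta> B by (simp add: measure_distr)
    qed
    have "measure P {\<omega>\<in>space P. \<forall>j\<in>J. W j \<omega> \<in> A j} = measure Q {\<omega>\<in>space P. \<forall>j\<in>J. W j \<omega> \<in> A j}"
      using *[OF P refl BP] *[OF Q sets BQ] brownian_increments_distr_eq[OF P Q BP BQ, of r] r by simp
    moreover have "{\<omega>\<in>space P. \<forall>j\<in>J. ?f \<omega> j \<in> A j} = {\<omega>\<in>space P. \<forall>j\<in>J. W j \<omega> \<in> A j}"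
      using J by auto
    ultimately show "measure P {\<omega>\<in>space P. \<forall>j\<in>J. ?f \<omega> j \<in> A j} =
      (1 - 0) * measure Q {\<omega>\<in>space P. \<forall>j\<in>J. ?f \<omega> j \<in> A j} +
      0 * measure Q {\<omega>\<in>space P. \<forall>j\<in>J. ?f \<omega> j \<in> A j}" by simp
  qed
  from mixture_onD[OF this E] show ?thesis using f E by (simp add: measure_distr sp)
qed

section \<open>The path law of a Markov chain is affine in its initial law\<close>

text \<open>The Markov property integrated over an event of the past. The right-hand side is linear
  in the measure, and its coefficients depend only on \<open>G\<close> and the elapsed time; this is
  what carries a mixture from one time to the next.\<close>

lemma markov_chain_step:
  assumes "prob_space M" and mc: "markov_chain M S G Y" and st: "0 \<le> s" "s \<le> t" and y: "y \<in> S"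
    and A: "A \<in> sets (natural_filtration (space M) Y (ennreal s))"
  shows "measure M (A \<inter> {\<omega>\<in>space M. Y t \<omega> = y}) =
    (\<Sum>z\<in>S. transition_prob S G (t - s) z y * measure M (A \<inter> {\<omega>\<in>space M. Y s \<omega> = z}))"
proof -
  interpret prob_space M by fact
  let ?F = "natural_filtration (space M) Y (ennreal s)"
  let ?T = "transition_prob S G (t - s)"
  have S: "finite S" "\<And>\<omega> t. 0 \<le> t \<Longrightarrow> \<omega> \<in> space M \<Longrightarrow> Y t \<omega> \<in> S"
    and Y: "\<And>t. 0 \<le> t \<Longrightarrow> Y t \<in> borel_measurable M"
    using mc by (auto simp: markov_chain_def)
  have sub: "subalgebra M ?F" using Y by (rule subalgebra_natural_filtration)
  interpret finite_measure_subalgebra M ?F by standard (rule sub)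
  have AM: "A \<in> sets M" using A sub by (auto simp: subalgebra_def)
  have ev: "{\<omega>\<in>space M. Y u \<omega> = z} \<in> sets M" if "0 \<le> u" for u z
    using Y[OF that] by measurable
  have AE: "AE \<omega> in M. real_cond_exp M ?F (indicator {\<omega>\<in>space M. Y t \<omega> = y}) \<omega> = ?T (Y s \<omega>) y"
    using mc st y by (auto simp: markov_chain_def)
  have "measure M (A \<inter> {\<omega>\<in>space M. Y t \<omega> = y}) = (\<integral>\<omega>\<in>A. indicator {\<omega>\<in>space M. Y t \<omega> = y} \<omega> \<partial>M)"
    using AM ev[of t y] st sets.sets_into_space[OF AM]
    by (simp add: set_lebesgue_integral_def indicator_inter_arith[symmetric] Int_absorb1 Int_assoc)
  also have "\<dots> = (\<integral>\<omega>\<in>A. real_cond_exp M ?F (indicator {\<omega>\<in>space M. Y t \<omega> = y}) \<omega> \<partial>M)"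
    using ev[of t y] st A by (intro real_cond_exp_intA) (auto intro!: integrable_real_indicator simp: less_top[symmetric])
  \<comment> \<open>The random transition probability is split over the possible states at time
    \<open>s\<close>; at each sample point one summand survives.\<close>
  also have "\<dots> = (\<integral>\<omega>\<in>A. (\<Sum>z\<in>S. ?T z y * indicator {\<omega>\<in>space M. Y s \<omega> = z} \<omega>) \<partial>M)"
    unfolding set_lebesgue_integral_def
  proof (rule integral_cong_AE)
    show "AE \<omega> in M. indicator A \<omega> *\<^sub>R real_cond_exp M ?F (indicator {\<omega>\<in>space M. Y t \<omega> = y}) \<omega> =
      indicator A \<omega> *\<^sub>R (\<Sum>z\<in>S. ?T z y * indicator {\<omega>\<in>space M. Y s \<omega> = z} \<omega>)"
      using AE AE_space
    proof eventually_elim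
      case (elim \<omega>)
      have "(\<Sum>z\<in>S. ?T z y * indicator {\<omega>\<in>space M. Y s \<omega> = z} \<omega>) = (\<Sum>z\<in>S. if z = Y s \<omega> then ?T z y else 0)"
        using elim(2) by (intro sum.cong) (auto simp: indicator_def)
      then show ?case using elim S st by simp
    qed
  qed (use AM ev st in \<open>auto intro!: borel_measurable_sum borel_measurable_times borel_measurable_indicator
      borel_measurable_scaleR\<close>)
  also have "\<dots> = (\<integral>\<omega>. (\<Sum>z\<in>S. ?T z y * indicator (A \<inter> {\<omega>\<in>space M. Y s \<omega> = z}) \<omega>) \<partial>M)"
    unfolding set_lebesgue_integral_def
    by (intro Bochner_Integration.integral_cong refl)
      (simp add: sum_distrib_left indicator_inter_arith mult_ac)
  also have "\<dots> = (\<Sum>z\<in>S. ?T z y * measure M (A \<inter> {\<omega>\<in>space M. Y s \<omega> = z}))"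
  proof (subst Bochner_Integration.integral_sum)
    fix z
    have "A \<inter> {\<omega>\<in>space M. Y s \<omega> = z} \<in> sets M" using AM ev[OF st(1)] by (rule sets.Int)
    then show "integrable M (\<lambda>\<omega>. ?T z y * indicator (A \<inter> {\<omega>\<in>space M. Y s \<omega> = z}) \<omega>)"
      by (intro integrable_mult_right integrable_real_indicator) (simp_all add: less_top[symmetric])
  next
    have "A \<inter> {\<omega>\<in>space M. Y s \<omega> = z} \<inter> space M = A \<inter> {\<omega>\<in>space M. Y s \<omega> = z}" for z by blast
    then show "(\<Sum>z\<in>S. \<integral>\<omega>. ?T z y * indicator (A \<inter> {\<omega>\<in>space M. Y s \<omega> = z}) \<omega> \<partial>M) =
      (\<Sum>z\<in>S. ?T z y * measure M (A \<inter> {\<omega>\<in>space M. Y s \<omega> = z}))"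
      by simp
  qed
  finally show ?thesis .
qed

text \<open>The three chains share the generator \<open>G\<close> and differ only in their initial
  laws. The mixture at time \<open>0\<close> propagates by the linear recursion of
  \<open>markov_chain_step\<close>.\<close>

lemma markov_chain_path_mixture:
  assumes P: "prob_space P" and Q: "prob_space Q" and R: "prob_space R"
    and sets: "sets Q = sets P" "sets R = sets P"
    and mc: "markov_chain P S G Y" "markov_chain Q S G Y" "markov_chain R S G Y"
    and init: "\<And>y. y \<in> S \<Longrightarrow> measure P {\<omega>\<in>space P. Y 0 \<omega> = y} =
      (1 - a) * measure Q {\<omega>\<in>space P. Y 0 \<omega> = y} + a * measure R {\<omega>\<in>space P. Y 0 \<omega> = y}"
    and E: "E \<in> sets (PiM {0..} (\<lambda>_. borel))"
  shows "measure P ((\<lambda>\<omega>. \<lambda>t\<in>{0..}. Y t \<omega>) -` E \<inter> space P) =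
    (1 - a) * measure Q ((\<lambda>\<omega>. \<lambda>t\<in>{0..}. Y t \<omega>) -` E \<inter> space P) +
    a * measure R ((\<lambda>\<omega>. \<lambda>t\<in>{0..}. Y t \<omega>) -` E \<inter> space P)"
proof -
  let ?N = "PiM {0::real..} (\<lambda>_. borel :: real measure)" and ?f = "\<lambda>\<omega>. \<lambda>t\<in>{0::real..}. Y t \<omega>"
  have sp: "space Q = space P" "space R = space P" using sets by (auto dest: sets_eq_imp_space_eq)
  have S: "finite S" "\<And>\<omega> t. 0 \<le> t \<Longrightarrow> \<omega> \<in> space P \<Longrightarrow> Y t \<omega> \<in> S"
    and Y: "\<And>t. 0 \<le> t \<Longrightarrow> Y t \<in> borel_measurable P" "\<And>t. 0 \<le> t \<Longrightarrow> Y t \<in> borel_measurable Q"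
      "\<And>t. 0 \<le> t \<Longrightarrow> Y t \<in> borel_measurable R"
    using mc by (auto simp: markov_chain_def)
  have f: "?f \<in> measurable P ?N" "?f \<in> measurable Q ?N" "?f \<in> measurable R ?N"
    using Y by (auto intro!: measurable_path)
  have "mixture_on a (distr P ?N ?f) (distr Q ?N ?f) (distr R ?N ?f) (sets ?N)"
  proof (rule mixture_on_distr_PiM[OF P Q R sets f(1)])
    fix J :: "real set" and A :: "real \<Rightarrow> real set"
    assume J: "finite J" "J \<subseteq> {0..}" and A: "\<And>j. j \<in> J \<Longrightarrow> A j \<in> sets borel"
    \<comment> \<open>Inserting \<open>0\<close> makes the empty set of times correspond to time
      \<open>0\<close>, so the base case of the induction is the hypothesis on the initial
      law.\<close>
    define m where "m J = Max (insert 0 J)" for J :: "real set"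
    define C where "C J = {\<omega>\<in>space P. \<forall>j\<in>J. Y j \<omega> \<in> A j}" for J
    have CF: "C J \<in> sets (natural_filtration (space P) Y (ennreal u))"
      if "finite J" "J \<subseteq> {0..}" "\<forall>j\<in>J. j \<le> u" "\<And>j. j \<in> J \<Longrightarrow> A j \<in> sets borel" for J u
    proof -
      have "{\<omega>\<in>space (natural_filtration (space P) Y (ennreal u)). \<forall>j\<in>J. Y j \<omega> \<in> A j}
        \<in> sets (natural_filtration (space P) Y (ennreal u))"
      proof (rule sets_cylinder[OF that(1)])
        fix j assume "j \<in> J"
        then show "Y j \<in> borel_measurable (natural_filtration (space P) Y (ennreal u))"
          using that(2,3) by (intro measurable_natural_filtration) (auto intro!: ennreal_leI)
      qed (rule that(4))
      then show ?thesis by (simp add: C_def)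
    qed
    \<comment> \<open>The induction adds the largest time last. The claim records the state at the
      last time, because the recursion needs that state; summing over it afterwards recovers the
      cylinder.\<close>
    have main: "measure P (C J \<inter> {\<omega>\<in>space P. Y (m J) \<omega> = y}) =
        (1 - a) * measure Q (C J \<inter> {\<omega>\<in>space P. Y (m J) \<omega> = y}) +
        a * measure R (C J \<inter> {\<omega>\<in>space P. Y (m J) \<omega> = y})" if "y \<in> S" for y
      using J A that
    proof (induction J arbitrary: y rule: finite_linorder_max_induct)
      case empty
      then show ?case using init[of y] by (simp add: m_def C_def Int_absorb1)
    next
      case (insert b K)
      have K: "K \<subseteq> {0..}" "0 \<le> b" "\<And>j. j \<in> K \<Longrightarrow> A j \<in> sets borel" using insert.prems by auto
      have mb: "m (insert b K) = b" unfolding m_def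
        using insert.hyps K by (intro Max_eqI) (auto intro: less_imp_le)
      have mK: "0 \<le> m K" "m K \<le> b" "\<forall>j\<in>K. j \<le> m K"
        unfolding m_def using insert.hyps K by (auto intro: less_imp_le)
      have eq: "C (insert b K) \<inter> {\<omega>\<in>space P. Y b \<omega> = y} =
          (if y \<in> A b then C K \<inter> {\<omega>\<in>space P. Y b \<omega> = y} else {})"
        by (auto simp: C_def)
      have CK: "C K \<in> sets (natural_filtration (space P) Y (ennreal (m K)))"
        using insert.hyps K mK by (intro CF) auto
      have step: "measure M (C K \<inter> {\<omega>\<in>space P. Y b \<omega> = y}) =
        (\<Sum>z\<in>S. transition_prob S G (b - m K) z y * measure M (C K \<inter> {\<omega>\<in>space P. Y (m K) \<omega> = z}))"
        if "prob_space M" "space M = space P" "markov_chain M S G Y" for M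
        using markov_chain_step[OF that(1,3) mK(1,2) insert.prems(3)] CK that(2) by simp
      have IH: "measure P (C K \<inter> {\<omega>\<in>space P. Y (m K) \<omega> = z}) =
        (1 - a) * measure Q (C K \<inter> {\<omega>\<in>space P. Y (m K) \<omega> = z}) +
        a * measure R (C K \<inter> {\<omega>\<in>space P. Y (m K) \<omega> = z})" if "z \<in> S" for z
        using insert.IH[OF K(1,3) that] by simp
      have "measure P (C K \<inter> {\<omega>\<in>space P. Y b \<omega> = y}) =
        (1 - a) * measure Q (C K \<inter> {\<omega>\<in>space P. Y b \<omega> = y}) +
        a * measure R (C K \<inter> {\<omega>\<in>space P. Y b \<omega> = y})"
        unfolding step[OF P refl mc(1)] step[OF Q sp(1) mc(2)] step[OF R sp(2) mc(3)]
        by (simp add: IH sum_distrib_left sum.distrib[symmetric] algebra_simps)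
      then show ?case unfolding mb eq by simp
    qed
    have tot: "measure M (C J) = (\<Sum>y\<in>S. measure M (C J \<inter> {\<omega>\<in>space P. Y (m J) \<omega> = y}))"
      if M: "prob_space M" "sets M = sets P" for M
    proof -
      interpret prob_space M by fact
      have spM: "space M = space P" using M(2) by (rule sets_eq_imp_space_eq)
      have mJ: "0 \<le> m J" unfolding m_def using J by simp
      have CJ: "C J \<in> sets P" unfolding C_def using J A Y(1) by (intro sets_cylinder[where N="\<lambda>_. borel"]) auto
      have "C J = (\<Union>y\<in>S. C J \<inter> {\<omega>\<in>space P. Y (m J) \<omega> = y})"
        using S(2)[OF mJ] by (auto simp: C_def)
      moreover have "{\<omega>\<in>space P. Y (m J) \<omega> = y} \<in> sets P" for y
        using Y(1)[OF mJ] by measurable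
      ultimately show ?thesis
        using S(1) CJ M(2)
        by (subst finite_measure_finite_Union[symmetric]) (auto simp: disjoint_family_on_def)
    qed
    have "{\<omega>\<in>space P. \<forall>j\<in>J. ?f \<omega> j \<in> A j} = C J"
      using J by (auto simp: C_def)
    then show "measure P {\<omega>\<in>space P. \<forall>j\<in>J. ?f \<omega> j \<in> A j} =
      (1 - a) * measure Q {\<omega>\<in>space P. \<forall>j\<in>J. ?f \<omega> j \<in> A j} +
      a * measure R {\<omega>\<in>space P. \<forall>j\<in>J. ?f \<omega> j \<in> A j}"
      by (simp add: tot[OF P refl] tot[OF Q sets(1)] tot[OF R sets(2)] main sum.distrib sum_distrib_left)
  qed
  from mixture_onD[OF this E] show ?thesis using f E by (simp add: measure_distr sp)
qed

section \<open>The observed coordinate paths\<close>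

text \<open>The unobserved signal is carried along with the observation because conditional
  expectations of \<open>Y\<close> given \<open>X\<close> depend on their joint law.\<close>

definition obs_path ::
    "('n \<Rightarrow> real \<Rightarrow> 'a \<Rightarrow> real) \<Rightarrow> (real \<Rightarrow> 'a \<Rightarrow> real^'n) \<Rightarrow> 'n \<Rightarrow> 'a \<Rightarrow> real \<Rightarrow> real \<times> real" where
  "obs_path Y X j \<omega> = (\<lambda>t\<in>{0..}. (X t \<omega> $ j, Y j t \<omega>))"

definition driver ::
    "('n \<Rightarrow> real \<Rightarrow> 'a \<Rightarrow> real) \<Rightarrow> ('n \<Rightarrow> real \<Rightarrow> 'a \<Rightarrow> real) \<Rightarrow> 'n + 'n \<Rightarrow> 'a \<Rightarrow> real \<Rightarrow> real" where
  "driver Y W = case_sum (\<lambda>i \<omega>. \<lambda>t\<in>{0..}. Y i t \<omega>) (\<lambda>i \<omega>. \<lambda>t\<in>{0..}. W i t \<omega>)"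

text \<open>The inner limit recovers a right-continuous path from its values at countably many times, which
  makes the functional measurable for the product sigma-algebra.\<close>

definition obs_map :: "real \<Rightarrow> 'n \<Rightarrow> ('n + 'n \<Rightarrow> real \<Rightarrow> real) \<Rightarrow> real \<Rightarrow> real \<times> real" where
  "obs_map m j z = (\<lambda>t\<in>{0..}.
     (m * (LINT s:{0..t}|lborel. lim (\<lambda>k. z (Inl j) (real (nat \<lceil>s * Suc k\<rceil>) / Suc k))) + z (Inr j) t,
      z (Inl j) t))"

lemma measurable_obs_map:
  "obs_map m j \<in> measurable (PiM {Inl j, Inr j} (\<lambda>_. PiM {0..} (\<lambda>_. borel))) (PiM {0..} (\<lambda>_. borel))"
proof -
  let ?N = "PiM {Inl j, Inr j} (\<lambda>_. PiM {0::real..} (\<lambda>_. borel :: real measure))"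
  have comp: "(\<lambda>z. z k t) \<in> borel_measurable ?N" if "k \<in> {Inl j, Inr j}" "0 \<le> t" for k t
    by (rule measurable_compose[OF measurable_component_singleton[OF that(1)]])
      (rule measurable_component_singleton, simp add: that(2))
  have [measurable]: "(\<lambda>(z, s). lim (\<lambda>k. z (Inl j) (real (nat \<lceil>s * Suc k\<rceil>) / Suc k)))
      \<in> borel_measurable (?N \<Otimes>\<^sub>M lborel)"
    using measurable_right_discretisation[of "\<lambda>t z. z (Inl j) t" ?N] comp by simp
  have [measurable]: "(\<lambda>z. z (Inl j) t) \<in> borel_measurable ?N" "(\<lambda>z. z (Inr j) t) \<in> borel_measurable ?N"
    if "0 \<le> t" for t using comp that by auto
  show ?thesis
    unfolding obs_map_def
  proof (rule measurable_restrict)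
    fix t :: real assume "t \<in> {0..}"
    then have [simp]: "0 \<le> t" by simp
    have "(\<lambda>z. LINT s:{0..t}|lborel. lim (\<lambda>k. z (Inl j) (real (nat \<lceil>s * Suc k\<rceil>) / Suc k)))
        \<in> borel_measurable ?N"
      unfolding set_lebesgue_integral_def
      by (rule lborel.borel_measurable_lebesgue_integral) measurable
    then show "(\<lambda>z. (m * (LINT s:{0..t}|lborel. lim (\<lambda>k. z (Inl j) (real (nat \<lceil>s * Suc k\<rceil>) / Suc k)))
        + z (Inr j) t, z (Inl j) t)) \<in> borel_measurable ?N"
      by measurable
  qed
qed

locale obs_model =
  fixes \<mu> lam :: "'n::finite \<Rightarrow> real" and \<pi> :: "real^'n" and M :: "'a measure"
    and Y W :: "'n \<Rightarrow> real \<Rightarrow> 'a \<Rightarrow> real" and X :: "real \<Rightarrow> 'a \<Rightarrow> real^'n"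
  assumes model: "observation_model \<mu> lam \<pi> M Y W X"

sublocale obs_model \<subseteq> prob_space M
  using model by (simp add: observation_model_def)

context obs_model begin

lemma
  shows markov: "markov_chain M {0, 1} (rate_matrix (lam i)) (Y i)"
    and init: "measure M {\<omega>\<in>space M. Y i 0 \<omega> = 1} = \<pi> $ i"
    and brownian: "brownian_motion M (W i)"
    and indep_driver: "indep_vars (\<lambda>_. PiM {0..} (\<lambda>_. borel)) (driver Y W) UNIV"
    and X_AE: "AE \<omega> in M. \<forall>t\<ge>0. \<forall>i. X t \<omega> $ i = \<mu> i * (LINT s:{0..t}|lborel. Y i s \<omega>) + W i t \<omega>"
  using model by (simp_all add: observation_model_def driver_def)

lemma measurable_X: "0 \<le> t \<Longrightarrow> X t \<in> borel_measurable M"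
  and measurable_Y: "0 \<le> t \<Longrightarrow> Y i t \<in> borel_measurable M"
  using model by (auto simp: observation_model_def markov_chain_def)

lemma Y_values: "0 \<le> t \<Longrightarrow> \<omega> \<in> space M \<Longrightarrow> Y i t \<omega> \<in> {0, 1}"
  using markov[of i] by (simp add: markov_chain_def)

lemma measurable_X_nth: "0 \<le> t \<Longrightarrow> (\<lambda>\<omega>. X t \<omega> $ j) \<in> borel_measurable M"
  by (rule measurable_compose[OF measurable_X])
    (auto intro!: borel_measurable_continuous_onI continuous_intros)

lemma measurable_obs_path: "obs_path Y X j \<in> measurable M (PiM {0..} (\<lambda>_. borel))"
  unfolding obs_path_def[abs_def]
  using measurable_X_nth measurable_Y by (intro measurable_path) simp

text \<open>Both ingredients hold only almost surely: the integral formula for \<open>X\<close>, and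
  the right-continuity of \<open>Y\<close> through which the limit in \<open>obs_map\<close> returns
  the path.\<close>

lemma obs_path_AE: "AE \<omega> in M. \<forall>j. obs_path Y X j \<omega> = obs_map (\<mu> j) j (\<lambda>k\<in>{Inl j, Inr j}. driver Y W k \<omega>)"
proof -
  have "AE \<omega> in M. \<forall>i. \<forall>t\<ge>0. continuous (at_right t) (\<lambda>s. Y i s \<omega>)"
    using markov by (intro AE_all_countable[THEN iffD2]) (simp add: markov_chain_def)
  with X_AE show ?thesis
  proof eventually_elim
    case (elim \<omega>)
    show ?case
    proof (intro allI)
      fix j
      have "(LINT s:{0..t}|lborel. lim (\<lambda>k. (\<lambda>u\<in>{0..}. Y j u \<omega>) (real (nat \<lceil>s * Suc k\<rceil>) / Suc k))) =
        (LINT s:{0..t}|lborel. Y j s \<omega>)" for t :: real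
      proof (rule set_lebesgue_integral_cong, simp, intro allI impI)
        fix s assume "s \<in> {0..t}"
        then have "(\<lambda>k. Y j (real (nat \<lceil>s * Suc k\<rceil>) / Suc k) \<omega>) \<longlonglongrightarrow> Y j s \<omega>"
          using elim(2) by (intro tendsto_right_discretisation) auto
        then show "lim (\<lambda>k. (\<lambda>u\<in>{0..}. Y j u \<omega>) (real (nat \<lceil>s * Suc k\<rceil>) / Suc k)) = Y j s \<omega>"
          by (simp add: limI)
      qed
      then show "obs_path Y X j \<omega> = obs_map (\<mu> j) j (\<lambda>k\<in>{Inl j, Inr j}. driver Y W k \<omega>)"
        using elim(1) by (auto simp: obs_path_def obs_map_def driver_def restrict_def)
    qed
  qed
qed

lemma measurable_driver: "driver Y W k \<in> measurable M (PiM {0..} (\<lambda>_. borel))"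
  using indep_driver by (auto simp: indep_vars_def)

lemma measurable_driver_pair:
  "(\<lambda>\<omega>. \<lambda>k\<in>{Inl j, Inr j}. driver Y W k \<omega>)
    \<in> measurable M (PiM {Inl j, Inr j} (\<lambda>_. PiM {0..} (\<lambda>_. borel)))"
  using measurable_driver by (intro measurable_restrict)

text \<open>Distinct coordinates use disjoint pairs of drivers, so their images under
  \<open>obs_map\<close> are independent. As \<open>obs_path\<close> agrees with these images only
  almost everywhere, independence is transferred through the joint law, which null sets do not
  affect.\<close>

lemma indep_obs_path: "indep_vars (\<lambda>_. PiM {0..} (\<lambda>_. borel)) (obs_path Y X) UNIV"
proof -
  let ?N = "PiM {0::real..} (\<lambda>_. borel :: (real \<times> real) measure)"
  let ?D = "\<lambda>j \<omega>. \<lambda>k\<in>{Inl j, Inr j}. driver Y W k \<omega>"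
  have "indep_vars (\<lambda>j. PiM {Inl j, Inr j} (\<lambda>_. PiM {0..} (\<lambda>_. borel))) ?D (UNIV :: 'n set)"
    using indep_driver by (rule indep_vars_restrict) (auto simp: disjoint_family_on_def)
  then have ind: "indep_vars (\<lambda>_. ?N) (\<lambda>j \<omega>. obs_map (\<mu> j) j (?D j \<omega>)) UNIV"
    by (rule indep_vars_compose2) (rule measurable_obs_map)
  have rv: "(\<lambda>\<omega>. obs_map (\<mu> j) j (?D j \<omega>)) \<in> measurable M ?N" for j
    using measurable_driver_pair measurable_obs_map by (rule measurable_compose)
  have "distr M (PiM UNIV (\<lambda>_. ?N)) (\<lambda>\<omega>. \<lambda>j\<in>UNIV. obs_path Y X j \<omega>) =
    distr M (PiM UNIV (\<lambda>_. ?N)) (\<lambda>\<omega>. \<lambda>j\<in>UNIV. obs_map (\<mu> j) j (?D j \<omega>))"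
  proof (rule distr_cong_AE)
    show "AE \<omega> in M. (\<lambda>j\<in>UNIV. obs_path Y X j \<omega>) = (\<lambda>j\<in>UNIV. obs_map (\<mu> j) j (?D j \<omega>))"
      using obs_path_AE by eventually_elim auto
    show "(\<lambda>\<omega>. \<lambda>j\<in>UNIV. obs_path Y X j \<omega>) \<in> measurable M (PiM UNIV (\<lambda>_. ?N))"
      using measurable_obs_path by (rule measurable_restrict)
    show "(\<lambda>\<omega>. \<lambda>j\<in>UNIV. obs_map (\<mu> j) j (?D j \<omega>)) \<in> measurable M (PiM UNIV (\<lambda>_. ?N))"
      using rv by (rule measurable_restrict)
  qed auto
  also have "\<dots> = PiM UNIV (\<lambda>j. distr M ?N (\<lambda>\<omega>. obs_map (\<mu> j) j (?D j \<omega>)))"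
    by (rule indep_vars_iff_distr_eq_PiM[THEN iffD1, OF _ rv ind]) simp
  also have "\<dots> = PiM UNIV (\<lambda>j. distr M ?N (obs_path Y X j))"
  proof (rule PiM_cong[OF refl], rule distr_cong_AE)
    fix j
    show "AE \<omega> in M. obs_map (\<mu> j) j (?D j \<omega>) = obs_path Y X j \<omega>"
      using obs_path_AE by eventually_elim auto
  qed (use rv measurable_obs_path in auto)
  finally show ?thesis
    by (rule indep_vars_iff_distr_eq_PiM[THEN iffD2, OF _ measurable_obs_path, rotated]) simp
qed

end

lemma measurable_sets_eq_cong:
  assumes "sets Q = sets P" "f \<in> measurable P N" shows "f \<in> measurable Q N"
  using assms measurable_cong_sets[OF assms(1) refl] by blast

text \<open>The law of a driver pair is the product of a signal law affine in the prior and a noise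
  law that is the same for all priors. Hence it is affine, and \<open>obs_map\<close>, one
  functional for all three measures, preserves this.\<close>

lemma obs_path_mixture:
  assumes P: "obs_model \<mu> lam \<pi> P Y W X" and Q: "obs_model \<mu> lam \<pi>' Q Y W X"
    and R: "obs_model \<mu> lam \<pi>'' R Y W X"
    and sets: "sets Q = sets P" "sets R = sets P"
    and coord: "\<pi> $ j = (1 - a) * \<pi>' $ j + a * \<pi>'' $ j"
    and E: "E \<in> sets (PiM {0..} (\<lambda>_. borel))"
  shows "measure P (obs_path Y X j -` E \<inter> space P) =
    (1 - a) * measure Q (obs_path Y X j -` E \<inter> space P) + a * measure R (obs_path Y X j -` E \<inter> space P)"
proof -
  interpret P: obs_model \<mu> lam \<pi> P Y W X by fact
  interpret Q: obs_model \<mu> lam \<pi>' Q Y W X by fact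
  interpret R: obs_model \<mu> lam \<pi>'' R Y W X by fact
  have sp: "space Q = space P" "space R = space P" using sets by (auto dest: sets_eq_imp_space_eq)
  let ?N2 = "PiM {Inl j, Inr j} (\<lambda>_. PiM {0::real..} (\<lambda>_. borel :: real measure))"
  let ?D = "\<lambda>\<omega>. \<lambda>k\<in>{Inl j, Inr j}. driver Y W k \<omega>"
  let ?Yp = "\<lambda>\<omega>. \<lambda>t\<in>{0::real..}. Y j t \<omega>" and ?Wp = "\<lambda>\<omega>. \<lambda>t\<in>{0::real..}. W j t \<omega>"
  \<comment> \<open>The model prescribes only the mass of state \<open>1\<close>; state
    \<open>0\<close> is its complement, as the chain takes no other values.\<close>
  have init0: "measure M {\<omega>\<in>space M. Y j 0 \<omega> = 0} = 1 - q $ j" if "obs_model \<mu> lam q M Y W X" for M q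
  proof -
    interpret M: obs_model \<mu> lam q M Y W X by fact
    have "{\<omega>\<in>space M. Y j 0 \<omega> = 1} \<in> sets M" using M.measurable_Y[of 0 j] by measurable
    moreover have "{\<omega>\<in>space M. Y j 0 \<omega> = 0} = space M - {\<omega>\<in>space M. Y j 0 \<omega> = 1}"
      using M.Y_values[of 0 _ j] by auto
    ultimately show ?thesis using M.prob_compl M.init[of j] by simp
  qed
  have init: "measure P {\<omega>\<in>space P. Y j 0 \<omega> = y} =
      (1 - a) * measure Q {\<omega>\<in>space P. Y j 0 \<omega> = y} + a * measure R {\<omega>\<in>space P. Y j 0 \<omega> = y}"
    if "y \<in> {0, 1}" for y
  proof (cases "y = 0")
    case True
    show ?thesis
      unfolding True init0[OF P] init0[OF Q, unfolded sp] init0[OF R, unfolded sp] coord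
      by (simp add: algebra_simps)
  next
    case False
    then have "y = 1" using that by simp
    then show ?thesis using P.init[of j] Q.init[of j] R.init[of j] unfolding sp by (simp add: coord)
  qed
  have mix: "mixture_on a (distr P ?N2 ?D) (distr Q ?N2 ?D) (distr R ?N2 ?D) (sets ?N2)"
  proof (rule mixture_on_distr_PiM_finite)
    fix A assume A: "\<And>k. k \<in> {Inl j, Inr j} \<Longrightarrow> A k \<in> sets (PiM {0::real..} (\<lambda>_. borel :: real measure))"
    let ?A = "?Yp -` A (Inl j) \<inter> space P" and ?B = "?Wp -` A (Inr j) \<inter> space P"
    have *: "measure M {\<omega>\<in>space P. \<forall>k\<in>{Inl j, Inr j}. ?D \<omega> k \<in> A k} = measure M ?A * measure M ?B"
      if M: "obs_model \<mu> lam q M Y W X" "space M = space P" for M q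
    proof -
      interpret M: obs_model \<mu> lam q M Y W X by fact
      have "{\<omega>\<in>space P. \<forall>k\<in>{Inl j, Inr j}. ?D \<omega> k \<in> A k} =
          (\<Inter>k\<in>{Inl j, Inr j}. driver Y W k -` A k \<inter> space M)"
        using M(2) by auto
      then show ?thesis
        using M.indep_varsD[OF M.indep_driver, of "{Inl j, Inr j}" A] A M(2) by (simp add: driver_def)
    qed
    have Y: "measure P ?A = (1 - a) * measure Q ?A + a * measure R ?A"
      by (rule markov_chain_path_mixture[OF P.prob_space_axioms Q.prob_space_axioms
            R.prob_space_axioms sets P.markov Q.markov R.markov init]) (use A in auto)
    have W: "measure Q ?B = measure P ?B" "measure R ?B = measure P ?B"
      using brownian_path_prob_eq[OF P.prob_space_axioms Q.prob_space_axioms sets(1) P.brownian Q.brownian, of "A (Inr j)" j]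
        brownian_path_prob_eq[OF P.prob_space_axioms R.prob_space_axioms sets(2) P.brownian R.brownian, of "A (Inr j)" j] A
      by auto
    show "measure P {\<omega>\<in>space P. \<forall>k\<in>{Inl j, Inr j}. ?D \<omega> k \<in> A k} =
      (1 - a) * measure Q {\<omega>\<in>space P. \<forall>k\<in>{Inl j, Inr j}. ?D \<omega> k \<in> A k} +
      a * measure R {\<omega>\<in>space P. \<forall>k\<in>{Inl j, Inr j}. ?D \<omega> k \<in> A k}"
      unfolding *[OF P refl] *[OF Q sp(1)] *[OF R sp(2)] Y W by (simp add: algebra_simps)
  qed (use P.measurable_driver_pair sets P.prob_space_axioms Q.prob_space_axioms R.prob_space_axioms in auto)
  have law: "measure M (obs_path Y X j -` E \<inter> space P) =
      measure (distr M ?N2 ?D) (obs_map (\<mu> j) j -` E \<inter> space ?N2)"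
    if M: "obs_model \<mu> lam q M Y W X" "space M = space P" for M q
  proof -
    interpret M: obs_model \<mu> lam q M Y W X by fact
    have "measure M (obs_path Y X j -` E \<inter> space P) = measure M ((\<lambda>\<omega>. obs_map (\<mu> j) j (?D \<omega>)) -` E \<inter> space M)"
    proof (rule measure_eq_AE)
      show "AE \<omega> in M. \<omega> \<in> obs_path Y X j -` E \<inter> space P \<longleftrightarrow>
          \<omega> \<in> (\<lambda>\<omega>. obs_map (\<mu> j) j (?D \<omega>)) -` E \<inter> space M"
        using M.obs_path_AE by eventually_elim (auto simp: M(2))
      show "obs_path Y X j -` E \<inter> space P \<in> sets M"
        unfolding M(2)[symmetric] using M.measurable_obs_path E by (rule measurable_sets)
      show "(\<lambda>\<omega>. obs_map (\<mu> j) j (?D \<omega>)) -` E \<inter> space M \<in> sets M"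
        using measurable_compose[OF M.measurable_driver_pair measurable_obs_map] E by (rule measurable_sets)
    qed
    also have "\<dots> = measure (distr M ?N2 ?D) (obs_map (\<mu> j) j -` E \<inter> space ?N2)"
    proof (subst measure_distr[OF M.measurable_driver_pair])
      show "obs_map (\<mu> j) j -` E \<inter> space ?N2 \<in> sets ?N2"
        using measurable_obs_map E by (rule measurable_sets)
      show "measure M ((\<lambda>\<omega>. obs_map (\<mu> j) j (?D \<omega>)) -` E \<inter> space M) =
          measure M (?D -` (obs_map (\<mu> j) j -` E \<inter> space ?N2) \<inter> space M)"
        using measurable_space[OF M.measurable_driver_pair[of j]]
        by (intro arg_cong[where f="measure M"]) auto
    qed
    finally show ?thesis .
  qed
  show ?thesis
    unfolding law[OF P refl] law[OF Q sp(1)] law[OF R sp(2)]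
    by (rule mixture_onD[OF mix measurable_sets[OF measurable_obs_map E]])
qed

section \<open>Independence of the observations across coordinates\<close>

lemma measurable_vecI:
  fixes f :: "'a \<Rightarrow> real^'n::finite"
  assumes "\<And>j. (\<lambda>\<omega>. f \<omega> $ j) \<in> borel_measurable N"
  shows "f \<in> borel_measurable N"
proof (subst borel_measurable_euclidean_space, safe)
  fix b :: "real^'n" assume "b \<in> Basis"
  then obtain j where "b = axis j 1" by (auto simp: Basis_vec_def)
  then show "(\<lambda>\<omega>. f \<omega> \<bullet> b) \<in> borel_measurable N" using assms[of j] by (simp add: inner_axis)
qed

lemma sets_natural_filtration_subset:
  assumes "space N = \<Omega>" "\<And>s. 0 \<le> s \<Longrightarrow> ennreal s \<le> t \<Longrightarrow> Z s \<in> borel_measurable N"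
  shows "sets (natural_filtration \<Omega> Z t) \<subseteq> sets N"
proof -
  have "{Z s -` A \<inter> \<Omega> | s A. 0 \<le> s \<and> ennreal s \<le> t \<and> A \<in> sets borel} \<subseteq> sets N"
    using assms by (auto intro: measurable_sets)
  then have "sigma_sets (space N) {Z s -` A \<inter> \<Omega> | s A. 0 \<le> s \<and> ennreal s \<le> t \<and> A \<in> sets borel} \<subseteq> sets N"
    by (rule sets.sigma_sets_subset)
  then show ?thesis
    unfolding natural_filtration_def by (subst sets_measure_of) (auto simp: assms(1))
qed

text \<open>The pi-lambda argument for set integrals. Having the whole space in \<open>\<G>\<close>
  yields equal total integrals, from which complements are obtained by subtraction.\<close>

lemma set_integral_eq_sigma_sets:
  fixes f g :: "'a \<Rightarrow> real"
  assumes int: "integrable M f" "integrable M g"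
    and \<G>: "\<G> \<subseteq> sets M" "Int_stable \<G>" "space M \<in> \<G>"
    and eq: "\<And>A. A \<in> \<G> \<Longrightarrow> (LINT x:A|M. f x) = (LINT x:A|M. g x)"
    and A: "A \<in> sigma_sets (space M) \<G>"
  shows "(LINT x:A|M. f x) = (LINT x:A|M. g x)"
proof -
  have sub: "sigma_sets (space M) \<G> \<subseteq> sets M"
    using \<G> by (simp add: sets.sigma_sets_subset)
  have si: "set_integrable M B h" if "B \<in> sets M" "integrable M h" for B and h :: "'a \<Rightarrow> real"
    unfolding set_integrable_def using that by (rule integrable_mult_indicator)
  from \<G>(2) order_trans[OF \<G>(1) sets.space_closed] A show ?thesis
  proof (induct rule: sigma_sets_induct_disjoint)
    case (compl B)
    have B: "B \<in> sets M" using compl(1) sub by auto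
    have "(LINT x:space M|M. h x) = (LINT x:space M - B|M. h x) + (LINT x:B|M. h x)"
      if "integrable M h" for h :: "'a \<Rightarrow> real"
    proof -
      have "space M - B \<union> B = space M" using sets.sets_into_space[OF B] by auto
      moreover have "(LINT x:(space M - B) \<union> B|M. h x) = (LINT x:space M - B|M. h x) + (LINT x:B|M. h x)"
        by (rule set_integral_Un) (auto intro: si[OF _ that] sets.compl_sets B)
      ultimately show ?thesis by simp
    qed
    from this[OF int(1)] this[OF int(2)] show ?case using compl(2) eq[OF \<G>(3)] by linarith
  next
    case (union B)
    have B: "B i \<in> sets M" for i using union(2) sub by auto
    have "(LINT x:(\<Union>i. B i)|M. h x) = (\<Sum>i. LINT x:B i|M. h x)" if "integrable M h" for h :: "'a \<Rightarrow> real"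
      using union(1) B that si by (intro lebesgue_integral_countable_add) (auto simp: disjoint_family_on_def)
    then show ?case using union(3) int by simp
  qed (use eq in \<open>auto simp: set_lebesgue_integral_def\<close>)
qed

lemma AE_abs_le_integrable:
  assumes "finite_measure M" "f \<in> borel_measurable M" "AE x in M. \<bar>f x\<bar> \<le> (c::real)"
  shows "integrable M f"
  using assms by (intro finite_measure.integrable_const_bound[where B=c]) (simp_all only: real_norm_def)

definition obs_algebra ::
    "('n \<Rightarrow> real \<Rightarrow> 'a \<Rightarrow> real) \<Rightarrow> (real \<Rightarrow> 'a \<Rightarrow> real^'n) \<Rightarrow> 'a set \<Rightarrow> 'n \<Rightarrow> 'a measure" where
  "obs_algebra Y X \<Omega> j = vimage_algebra \<Omega> (obs_path Y X j) (PiM {0..} (\<lambda>_. borel))"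

definition rectangles :: "('n::finite \<Rightarrow> 'a measure) \<Rightarrow> 'a set set" where
  "rectangles \<A> = {(\<Inter>j. E j) | E. \<forall>j. E j \<in> sets (\<A> j)}"

text \<open>Generated by rectangles rather than by the vector-valued paths, so that independence
  across coordinates applies directly to an intersection-stable generator.\<close>

definition obs_total ::
    "('n::finite \<Rightarrow> real \<Rightarrow> 'a \<Rightarrow> real) \<Rightarrow> (real \<Rightarrow> 'a \<Rightarrow> real^'n) \<Rightarrow> 'a set \<Rightarrow> 'a measure" where
  "obs_total Y X \<Omega> = sigma \<Omega> (rectangles (obs_algebra Y X \<Omega>))"

lemma Int_stable_rectangles: "Int_stable (rectangles \<A>)"
proof (rule Int_stableI)
  fix A B assume "A \<in> rectangles \<A>" "B \<in> rectangles \<A>"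
  then obtain E F where "A = (\<Inter>j. E j)" "B = (\<Inter>j. F j)" "\<forall>j. E j \<in> sets (\<A> j)" "\<forall>j. F j \<in> sets (\<A> j)"
    by (auto simp: rectangles_def)
  then have "A \<inter> B = (\<Inter>j. E j \<inter> F j)" "\<forall>j. E j \<inter> F j \<in> sets (\<A> j)" by auto
  then show "A \<inter> B \<in> rectangles \<A>" unfolding rectangles_def by blast
qed

lemma rectangles_side:
  assumes "A \<in> sets (\<A> j)" "\<And>k. space (\<A> k) = \<Omega>"
  shows "A \<in> rectangles \<A>"
proof -
  have "A \<subseteq> \<Omega>" using assms sets.sets_into_space by metis
  then have "A = (\<Inter>k. if k = j then A else \<Omega>)" by (auto split: if_splits)
  moreover have "\<Omega> \<in> sets (\<A> k)" for k using assms(2) sets.top by metis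
  then have "\<forall>k. (if k = j then A else \<Omega>) \<in> sets (\<A> k)" using assms(1) by auto
  ultimately show ?thesis unfolding rectangles_def by blast
qed

lemma rectangles_space:
  assumes "\<And>k. space (\<A> k) = \<Omega>" shows "\<Omega> \<in> rectangles \<A>"
  using rectangles_side[of \<Omega> \<A> undefined \<Omega>] assms sets.top by metis

lemma rectangles_subset_Pow:
  assumes "\<And>k. space (\<A> k) = \<Omega>" shows "rectangles \<A> \<subseteq> Pow \<Omega>"
  using assms sets.sets_into_space unfolding rectangles_def by fastforce

lemma rectangles_subset:
  fixes \<A> :: "'n::finite \<Rightarrow> 'a measure"
  assumes "\<And>k. sets (\<A> k) \<subseteq> sets M"
  shows "rectangles \<A> \<subseteq> sets M"
proof
  fix A assume "A \<in> rectangles \<A>"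
  then obtain E where "A = (\<Inter>j. E j)" and "\<And>j. E j \<in> sets (\<A> j)" by (auto simp: rectangles_def)
  then show "A \<in> sets M" using assms by (auto intro!: sets.finite_INT)
qed

lemma sets_sigma_rectangles:
  assumes "\<And>k. space (\<A> k) = \<Omega>"
  shows "sets (sigma \<Omega> (rectangles \<A>)) = sigma_sets \<Omega> (rectangles \<A>)"
    and "space (sigma \<Omega> (rectangles \<A>)) = \<Omega>"
  using rectangles_subset_Pow[of \<A> \<Omega>] assms by simp_all

lemma measurable_sigma_rectangles:
  assumes "f \<in> measurable (\<A> j) N" "\<And>k. space (\<A> k) = \<Omega>"
  shows "f \<in> measurable (sigma \<Omega> (rectangles \<A>)) N"
proof (rule measurableI)
  fix A assume "A \<in> sets N"
  then have "f -` A \<inter> \<Omega> \<in> sets (\<A> j)" using measurable_sets[OF assms(1)] assms(2) by metis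
  then have "f -` A \<inter> \<Omega> \<in> rectangles \<A>" using assms(2) by (rule rectangles_side)
  then show "f -` A \<inter> space (sigma \<Omega> (rectangles \<A>)) \<in> sets (sigma \<Omega> (rectangles \<A>))"
    using sets_sigma_rectangles[of \<A> \<Omega>] assms(2) by (simp add: sigma_sets.Basic)
qed (use sets_sigma_rectangles(2)[of \<A> \<Omega>] assms measurable_space[OF assms(1)] in simp)

lemma space_obs_algebra[simp]: "space (obs_algebra Y X \<Omega> j) = \<Omega>"
  by (simp add: obs_algebra_def)

lemma obs_path_in_space: "obs_path Y X j \<in> \<Omega> \<rightarrow> space (PiM {0..} (\<lambda>_. borel))"
  by (auto simp: obs_path_def space_PiM)

lemma sets_obs_algebra:
  "sets (obs_algebra Y X \<Omega> j) = {obs_path Y X j -` A \<inter> \<Omega> | A. A \<in> sets (PiM {0..} (\<lambda>_. borel))}"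
  unfolding obs_algebra_def using obs_path_in_space by (rule sets_vimage_algebra2)

lemma measurable_obs_algebra:
  assumes "0 \<le> t"
  shows "(\<lambda>\<omega>. X t \<omega> $ j) \<in> borel_measurable (obs_algebra Y X \<Omega> j)"
    and "Y j t \<in> borel_measurable (obs_algebra Y X \<Omega> j)"
proof -
  have "(\<lambda>\<omega>. obs_path Y X j \<omega> t) \<in> borel_measurable (obs_algebra Y X \<Omega> j)"
    unfolding obs_algebra_def
    using measurable_vimage_algebra1[OF obs_path_in_space]
    by (rule measurable_compose) (rule measurable_component_singleton, use assms in simp)
  moreover have "(\<lambda>\<omega>. obs_path Y X j \<omega> t) = (\<lambda>\<omega>. (X t \<omega> $ j, Y j t \<omega>))"
    using assms by (simp add: obs_path_def)
  ultimately have pair: "(\<lambda>\<omega>. (X t \<omega> $ j, Y j t \<omega>)) \<in> borel_measurable (obs_algebra Y X \<Omega> j)"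
    by simp
  have fs: "(fst :: real \<times> real \<Rightarrow> real) \<in> borel_measurable borel" "(snd :: real \<times> real \<Rightarrow> real) \<in> borel_measurable borel"
    by (auto intro!: borel_measurable_continuous_onI continuous_intros)
  show "(\<lambda>\<omega>. X t \<omega> $ j) \<in> borel_measurable (obs_algebra Y X \<Omega> j)"
    using measurable_compose[OF pair fs(1)] by simp
  show "Y j t \<in> borel_measurable (obs_algebra Y X \<Omega> j)"
    using measurable_compose[OF pair fs(2)] by simp
qed

lemma space_obs_total[simp]: "space (obs_total Y X \<Omega>) = \<Omega>"
  unfolding obs_total_def by (rule sets_sigma_rectangles) simp

lemma measurable_obs_total:
  assumes "0 \<le> t"
  shows "X t \<in> borel_measurable (obs_total Y X \<Omega>)" "Y j t \<in> borel_measurable (obs_total Y X \<Omega>)"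
  unfolding obs_total_def
  using measurable_obs_algebra[OF assms, where Y=Y and X=X and \<Omega>=\<Omega>]
  by (auto intro!: measurable_vecI measurable_sigma_rectangles)

lemma natural_filtration_subset_obs_total:
  "sets (natural_filtration \<Omega> X t) \<subseteq> sets (obs_total Y X \<Omega>)"
  using measurable_obs_total by (intro sets_natural_filtration_subset) auto

abbreviation coord_filtration :: "'a set \<Rightarrow> (real \<Rightarrow> 'a \<Rightarrow> real^'n) \<Rightarrow> ennreal \<Rightarrow> 'n \<Rightarrow> 'a measure" where
  "coord_filtration \<Omega> X t j \<equiv> natural_filtration \<Omega> (\<lambda>s \<omega>. X s \<omega> $ j) t"

lemma coord_filtration_subset_obs_algebra:
  "sets (coord_filtration \<Omega> X t j) \<subseteq> sets (obs_algebra Y X \<Omega> j)"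
  using measurable_obs_algebra by (intro sets_natural_filtration_subset) auto

text \<open>Lets conditional expectations given all observations be tested on rectangles, where the
  coordinates factor by independence.\<close>

lemma natural_filtration_subset_rectangles:
  fixes X :: "real \<Rightarrow> 'a \<Rightarrow> real^'n::finite"
  shows "sets (natural_filtration \<Omega> X t) \<subseteq> sigma_sets \<Omega> (rectangles (coord_filtration \<Omega> X t))"
proof -
  have "sets (natural_filtration \<Omega> X t) \<subseteq> sets (sigma \<Omega> (rectangles (coord_filtration \<Omega> X t)))"
  proof (rule sets_natural_filtration_subset)
    fix s :: real assume "0 \<le> s" "ennreal s \<le> t"
    then have "(\<lambda>\<omega>. X s \<omega> $ j) \<in> borel_measurable (coord_filtration \<Omega> X t j)" for j
      by (rule measurable_natural_filtration)
    then show "X s \<in> borel_measurable (sigma \<Omega> (rectangles (coord_filtration \<Omega> X t)))"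
      by (intro measurable_vecI measurable_sigma_rectangles) auto
  qed (simp add: sets_sigma_rectangles)
  then show ?thesis by (simp add: sets_sigma_rectangles)
qed

lemma coord_filtration_subset: "sets (coord_filtration \<Omega> X t j) \<subseteq> sets (natural_filtration \<Omega> X t)"
proof (rule sets_natural_filtration_subset)
  fix s :: real assume "0 \<le> s" "ennreal s \<le> t"
  then have "X s \<in> borel_measurable (natural_filtration \<Omega> X t)"
    by (rule measurable_natural_filtration)
  then show "(\<lambda>\<omega>. X s \<omega> $ j) \<in> borel_measurable (natural_filtration \<Omega> X t)"
    by (rule measurable_compose) (auto intro!: borel_measurable_continuous_onI continuous_intros)
qed simp

context obs_model begin

lemma subalgebra_obs_algebra: "subalgebra M (obs_algebra Y X (space M) j)"
  unfolding subalgebra_def using measurable_obs_path by (auto simp: sets_obs_algebra intro: measurable_sets)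

lemma indep_obs_algebra: "indep_sets (\<lambda>j. sets (obs_algebra Y X (space M) j)) UNIV"
  using indep_obs_path by (simp add: indep_vars_def2 sets_obs_algebra)

lemma obs_total_subset: "sets (obs_total Y X (space M)) \<subseteq> sets M"
proof -
  have "rectangles (obs_algebra Y X (space M)) \<subseteq> sets M"
    using subalgebra_obs_algebra by (intro rectangles_subset) (simp add: subalgebra_def)
  then show ?thesis
    unfolding obs_total_def by (simp add: sets_sigma_rectangles sets.sigma_sets_subset)
qed

lemma prob_rectangle:
  assumes "\<And>j. E j \<in> sets (obs_algebra Y X (space M) j)"
  shows "prob (\<Inter>j. E j) = (\<Prod>j\<in>UNIV. prob (E j))"
  using indep_setsD[OF indep_obs_algebra, of UNIV E] assms by simp

text \<open>Since \<open>f\<close> depends on coordinate \<open>j\<close> alone, it joins the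
  indicator of \<open>E j\<close>, and the integrand becomes a product of independent
  factors.\<close>

lemma set_integral_rectangle:
  assumes E: "\<And>j. E j \<in> sets (obs_algebra Y X (space M) j)"
    and f: "f \<in> borel_measurable (obs_algebra Y X (space M) j)" "integrable M f"
  shows "(LINT \<omega>:(\<Inter>j. E j)|M. f \<omega>) = (LINT \<omega>:E j|M. f \<omega>) * (\<Prod>k\<in>UNIV - {j}. prob (E k))"
proof -
  let ?A = "obs_algebra Y X (space M)"
  have EM: "E k \<in> sets M" for k using E subalgebra_obs_algebra unfolding subalgebra_def by blast
  define Z :: "'n \<Rightarrow> 'a \<Rightarrow> real" where "Z k \<omega> = indicator (E k) \<omega> * (if k = j then f \<omega> else 1)" for k \<omega>
  have Zm: "Z k \<in> borel_measurable (?A k)" for k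
    unfolding Z_def[abs_def] using E f(1) by (cases "k = j") auto
  have int: "integrable M (Z k)" for k
    unfolding Z_def[abs_def] using EM f(2) integrable_mult_indicator[of "E k" M f]
    by (cases "k = j") (auto intro!: integrable_real_indicator simp: less_top[symmetric])
  have "indep_vars (\<lambda>_. borel) Z UNIV"
    unfolding indep_vars_def2
  proof
    show "\<forall>i\<in>UNIV. random_variable borel (Z i)"
      using measurable_from_subalg[OF subalgebra_obs_algebra Zm] by blast
    show "indep_sets (\<lambda>i. {Z i -` A \<inter> space M |A. A \<in> sets borel}) UNIV"
      using measurable_sets[OF Zm] by (intro indep_sets_mono_sets[OF indep_obs_algebra]) auto
  qed
  then have "(\<integral>\<omega>. (\<Prod>k\<in>UNIV. Z k \<omega>) \<partial>M) = (\<Prod>k\<in>UNIV. \<integral>\<omega>. Z k \<omega> \<partial>M)"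
    using int by (intro indep_vars_lebesgue_integral) auto
  moreover have "(\<Prod>k\<in>UNIV. Z k \<omega>) = indicator (\<Inter>j. E j) \<omega> *\<^sub>R f \<omega>" for \<omega>
  proof -
    have "(\<Prod>k\<in>UNIV. Z k \<omega>) = (\<Prod>k\<in>UNIV. indicator (E k) \<omega>) * f \<omega>"
      by (simp add: Z_def prod.distrib)
    also have "(\<Prod>k\<in>UNIV. indicator (E k) \<omega>) = (indicator (\<Inter>j. E j) \<omega> :: real)"
      by (auto simp: indicator_def prod_zero_iff)
    finally show ?thesis by simp
  qed
  moreover have "(\<Prod>k\<in>UNIV. \<integral>\<omega>. Z k \<omega> \<partial>M) = (\<integral>\<omega>. Z j \<omega> \<partial>M) * (\<Prod>k\<in>UNIV-{j}. \<integral>\<omega>. Z k \<omega> \<partial>M)"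
    by (rule prod.remove) auto
  moreover have "(\<Prod>k\<in>UNIV-{j}. \<integral>\<omega>. Z k \<omega> \<partial>M) = (\<Prod>k\<in>UNIV-{j}. prob (E k))"
  proof (rule prod.cong[OF refl])
    fix k assume "k \<in> UNIV - {j}"
    moreover have "E k \<inter> space M = E k" using EM sets.sets_into_space by blast
    ultimately show "(\<integral>\<omega>. Z k \<omega> \<partial>M) = prob (E k)" by (simp add: Z_def)
  qed
  ultimately show ?thesis by (simp add: set_lebesgue_integral_def Z_def)
qed

lemma integrable_Y: "0 \<le> t \<Longrightarrow> integrable M (Y j t)"
  using measurable_Y Y_values[of t _ j]
  by (intro AE_abs_le_integrable[where c=1]) (fastforce intro!: AE_I2 simp: finite_measure_axioms)+

lemma subalgebra_natural: "subalgebra M (natural_filtration (space M) X t)"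
  using measurable_X by (rule subalgebra_natural_filtration)

lemma subalgebra_coord: "subalgebra M (coord_filtration (space M) X t j)"
  using measurable_X_nth by (rule subalgebra_natural_filtration)

end

section \<open>Changing one coordinate of the prior\<close>

lemma obs_algebra_mixture:
  assumes P: "obs_model \<mu> lam \<pi> P Y W X" and Q: "obs_model \<mu> lam \<pi>' Q Y W X"
    and R: "obs_model \<mu> lam \<pi>'' R Y W X"
    and sets: "sets Q = sets P" "sets R = sets P"
    and coord: "\<pi> $ j = (1 - a) * \<pi>' $ j + a * \<pi>'' $ j"
  shows "mixture_on a P Q R (sets (obs_algebra Y X (space P) j))"
  using obs_path_mixture[OF assms] by (auto simp: mixture_on_def sets_obs_algebra)

text \<open>The case of weight \<open>0\<close>, with \<open>Q\<close> in both slots: the law of one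
  coordinate depends only on its own prior.\<close>

lemma obs_algebra_measure_eq:
  assumes P: "obs_model \<mu> lam \<pi> P Y W X" and Q: "obs_model \<mu> lam \<pi>' Q Y W X"
    and sets: "sets Q = sets P" and coord: "\<pi> $ j = \<pi>' $ j"
    and E: "E \<in> sets (obs_algebra Y X (space P) j)"
  shows "measure P E = measure Q E"
  using mixture_onD[OF obs_algebra_mixture[OF P Q Q sets sets, of j 0] E] coord by simp

text \<open>On a rectangle each measure is a product over coordinates. The factor of coordinate
  \<open>i\<close> is affine and the others are common, so the product is affine. Changing two
  coordinates would give a product of two affine factors instead.\<close>

lemma obs_total_mixture:
  assumes P: "obs_model \<mu> lam \<pi> P Y W X" and Q: "obs_model \<mu> lam \<pi>' Q Y W X"
    and R: "obs_model \<mu> lam \<pi>'' R Y W X"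
    and sets: "sets Q = sets P" "sets R = sets P"
    and coord: "\<pi> $ i = (1 - a) * \<pi>' $ i + a * \<pi>'' $ i"
    and other: "\<And>j. j \<noteq> i \<Longrightarrow> \<pi>' $ j = \<pi> $ j" "\<And>j. j \<noteq> i \<Longrightarrow> \<pi>'' $ j = \<pi> $ j"
  shows "mixture_on a P Q R (sets (obs_total Y X (space P)))"
proof -
  interpret P: obs_model \<mu> lam \<pi> P Y W X by fact
  interpret Q: obs_model \<mu> lam \<pi>' Q Y W X by fact
  interpret R: obs_model \<mu> lam \<pi>'' R Y W X by fact
  have sp: "space Q = space P" "space R = space P" using sets by (auto dest: sets_eq_imp_space_eq)
  have "mixture_on a P Q R (sigma_sets (space P) (rectangles (obs_algebra Y X (space P))))"
  proof (rule mixture_on_sigma_sets[OF P.prob_space_axioms Q.prob_space_axioms R.prob_space_axioms sets])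
    show "rectangles (obs_algebra Y X (space P)) \<subseteq> sets P"
      using P.obs_total_subset by (auto simp: obs_total_def sets_sigma_rectangles)
    show "mixture_on a P Q R (rectangles (obs_algebra Y X (space P)))"
    proof (rule mixture_onI)
      fix A assume "A \<in> rectangles (obs_algebra Y X (space P))"
      then obtain E where A: "A = (\<Inter>j. E j)" and E: "\<And>j. E j \<in> sets (obs_algebra Y X (space P) j)"
        by (auto simp: rectangles_def)
      have rest: "(\<Prod>k\<in>UNIV - {i}. measure Q (E k)) = (\<Prod>k\<in>UNIV - {i}. measure P (E k))"
        "(\<Prod>k\<in>UNIV - {i}. measure R (E k)) = (\<Prod>k\<in>UNIV - {i}. measure P (E k))"
        using obs_algebra_measure_eq[OF P Q sets(1) other(1)[symmetric] E]
          obs_algebra_measure_eq[OF P R sets(2) other(2)[symmetric] E]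
        by (auto intro!: prod.cong)
      have fac: "measure N A = measure N (E i) * (\<Prod>k\<in>UNIV - {i}. measure N (E k))"
        if "measure N (\<Inter>j. E j) = (\<Prod>j\<in>UNIV. measure N (E j))" for N
        unfolding A that by (rule prod.remove) auto
      show "measure P A = (1 - a) * measure Q A + a * measure R A"
        using fac[OF P.prob_rectangle[OF E]] fac[OF Q.prob_rectangle, unfolded sp, OF E]
          fac[OF R.prob_rectangle, unfolded sp, OF E] rest
          mixture_onD[OF obs_algebra_mixture[OF P Q R sets coord] E[of i]]
        by (simp add: algebra_simps)
    qed
  qed (rule Int_stable_rectangles)
  then show ?thesis by (simp add: obs_total_def sets_sigma_rectangles)
qed

lemma subalgebra_restr_eq:
  assumes "finite_measure P" "finite_measure Q" "subalgebra P F" "subalgebra Q F"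
    and "\<And>E. E \<in> sets F \<Longrightarrow> measure P E = measure Q E"
  shows "restr_to_subalg P F = restr_to_subalg Q F"
  using assms
  by (intro measure_eqI)
    (auto simp: sets_restr_to_subalg emeasure_restr_to_subalg finite_measure.emeasure_eq_measure)

lemma integral_cong_subalgebra:
  fixes f :: "'a \<Rightarrow> real"
  assumes "finite_measure P" "finite_measure Q" "subalgebra P F" "subalgebra Q F"
    and "\<And>E. E \<in> sets F \<Longrightarrow> measure P E = measure Q E"
    and f: "f \<in> borel_measurable F"
  shows "integral\<^sup>L P f = integral\<^sup>L Q f" and "integrable P f \<Longrightarrow> integrable Q f"
proof -
  have eq: "restr_to_subalg P F = restr_to_subalg Q F"
    by (rule subalgebra_restr_eq) fact+
  show "integral\<^sup>L P f = integral\<^sup>L Q f"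
    using integral_subalgebra2[OF assms(3) f] integral_subalgebra2[OF assms(4) f] eq by simp
  assume "integrable P f"
  then have "integrable (restr_to_subalg P F) f" using assms(3) f by (intro integrable_in_subalg)
  then show "integrable Q f" using assms(4) eq by (intro integrable_from_subalg[of Q F]) auto
qed

text \<open>By independence, the observations of the other coordinates carry no information on
  \<open>Y j\<close>; and the joint law of signal and observation in coordinate \<open>j\<close>
  depends only on \<open>\<pi> $ j\<close>. Hence one version, computed under \<open>P\<close>,
  serves under \<open>Q\<close> as well. This supplies a common function for all three
  measures.\<close>

lemma posterior_coordinate:
  assumes P: "obs_model \<mu> lam \<pi> P Y W X" and Q: "obs_model \<mu> lam \<pi>' Q Y W X"
    and sets: "sets Q = sets P" and coord: "\<pi> $ j = \<pi>' $ j" and t: "0 \<le> t"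
  shows "AE \<omega> in Q. real_cond_exp Q (natural_filtration (space P) X (ennreal t)) (Y j t) \<omega> =
    real_cond_exp P (coord_filtration (space P) X (ennreal t) j) (Y j t) \<omega>"
proof -
  interpret P: obs_model \<mu> lam \<pi> P Y W X by fact
  interpret Q: obs_model \<mu> lam \<pi>' Q Y W X by fact
  have sp: "space Q = space P" using sets by (rule sets_eq_imp_space_eq)
  let ?G = "natural_filtration (space P) X (ennreal t)"
  let ?C = "coord_filtration (space P) X (ennreal t)"
  let ?A = "obs_algebra Y X (space P)"
  let ?\<phi> = "real_cond_exp P (?C j) (Y j t)"
  interpret PC: finite_measure_subalgebra P "?C j" by standard (rule P.subalgebra_coord)
  interpret QG: finite_measure_subalgebra Q ?G
    by standard (use Q.subalgebra_natural[of "ennreal t"] sp in simp)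
  have \<phi>C: "?\<phi> \<in> borel_measurable (?C j)" by simp
  have \<phi>A: "?\<phi> \<in> borel_measurable (?A j)"
    by (rule measurable_from_subalg[OF _ \<phi>C]) (simp add: subalgebra_def coord_filtration_subset_obs_algebra)
  have \<phi>G: "?\<phi> \<in> borel_measurable ?G"
    by (rule measurable_from_subalg[OF _ \<phi>C]) (simp add: subalgebra_def coord_filtration_subset)
  have YA: "Y j t \<in> borel_measurable (?A j)" using t by (rule measurable_obs_algebra)
  have subP: "subalgebra P (?A j)" by (rule P.subalgebra_obs_algebra)
  have subQ: "subalgebra Q (?A j)" using Q.subalgebra_obs_algebra[of j] sp by simp
  note transfer = integral_cong_subalgebra[OF P.finite_measure_axioms Q.finite_measure_axioms subP subQ
      obs_algebra_measure_eq[OF P Q sets coord]]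
  have \<phi>P: "integrable P ?\<phi>" using P.integrable_Y[OF t] by (rule PC.real_cond_exp_int)
  have \<phi>Q: "integrable Q ?\<phi>" using transfer(2)[OF _ \<phi>A] \<phi>P by simp
  have rect: "(LINT \<omega>:E|Q. Y j t \<omega>) = (LINT \<omega>:E|Q. ?\<phi> \<omega>)" if "E \<in> rectangles ?C" for E
  proof -
    obtain B where E: "E = (\<Inter>k. B k)" and B: "\<And>k. B k \<in> sets (?C k)"
      using \<open>E \<in> rectangles ?C\<close> by (auto simp: rectangles_def)
    have BA: "B k \<in> sets (?A k)" for k using B coord_filtration_subset_obs_algebra by blast
    \<comment> \<open>The defining identity of the conditional expectation is available under
      \<open>P\<close>; both sides are moved between \<open>Q\<close> and \<open>P\<close> by the
      equality of the laws of coordinate \<open>j\<close>.\<close>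
    have "(LINT \<omega>:B j|Q. Y j t \<omega>) = (LINT \<omega>:B j|P. Y j t \<omega>)"
      unfolding set_lebesgue_integral_def using YA BA by (intro transfer(1)[symmetric]) auto
    also have "\<dots> = (LINT \<omega>:B j|P. ?\<phi> \<omega>)"
      using P.integrable_Y[OF t] B by (rule PC.real_cond_exp_intA)
    also have "\<dots> = (LINT \<omega>:B j|Q. ?\<phi> \<omega>)"
      unfolding set_lebesgue_integral_def using \<phi>A BA by (intro transfer(1)) auto
    finally have "(LINT \<omega>:B j|Q. Y j t \<omega>) = (LINT \<omega>:B j|Q. ?\<phi> \<omega>)" .
    then show ?thesis
      unfolding E
      using Q.set_integral_rectangle[unfolded sp, OF BA YA Q.integrable_Y[OF t]]
        Q.set_integral_rectangle[unfolded sp, OF BA \<phi>A \<phi>Q] by simp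
  qed
  show ?thesis
  proof (rule QG.real_cond_exp_charact)
    fix A assume "A \<in> sets ?G"
    then have "A \<in> sigma_sets (space Q) (rectangles ?C)"
      using natural_filtration_subset_rectangles[of "space P" X "ennreal t"] sp by auto
    then show "(LINT \<omega>:A|Q. Y j t \<omega>) = (LINT \<omega>:A|Q. ?\<phi> \<omega>)"
    proof (rule set_integral_eq_sigma_sets[OF Q.integrable_Y[OF t] \<phi>Q, rotated 4])
      show "rectangles ?C \<subseteq> sets Q"
        using Q.subalgebra_coord[where t="ennreal t"] sp by (intro rectangles_subset) (simp add: subalgebra_def)
      show "space Q \<in> rectangles ?C" using sp by (auto intro: rectangles_space)
    qed (use rect Int_stable_rectangles in auto)
  qed (use Q.integrable_Y[OF t] \<phi>Q \<phi>G in auto)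
qed

section \<open>Conditional expectations under a mixture\<close>

text \<open>On \<open>F\<close> the measure \<open>P\<close> is the sum of \<open>(1 - a) Q\<close>
  and \<open>a R\<close>, so both summands are absolutely continuous with respect to
  \<open>P\<close>, and their Radon-Nikodym derivatives add up to \<open>1\<close>.\<close>

lemma mixture_density:
  assumes P: "prob_space P" and Q: "prob_space Q" and R: "prob_space R"
    and sub: "subalgebra P F" "subalgebra Q F" "subalgebra R F"
    and mix: "mixture_on a P Q R (sets F)" and a: "0 \<le> a" "a \<le> 1"
  obtains D :: "'a \<Rightarrow> real" where "D \<in> borel_measurable F" "\<forall>x. 0 \<le> D x \<and> D x \<le> 1"
    "\<forall>f\<in>borel_measurable F.
      (\<integral>\<^sup>+x. ennreal (D x) * f x \<partial>P) = ennreal (1 - a) * (\<integral>\<^sup>+x. f x \<partial>Q)"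
    "\<forall>f\<in>borel_measurable F.
      (\<integral>\<^sup>+x. ennreal (1 - D x) * f x \<partial>P) = ennreal a * (\<integral>\<^sup>+x. f x \<partial>R)"
proof -
  interpret P: prob_space P by fact
  interpret Q: prob_space Q by fact
  interpret R: prob_space R by fact
  define p where "p = restr_to_subalg P F"
  define q where "q = scale_measure (ennreal (1 - a)) (restr_to_subalg Q F)"
  define r where "r = scale_measure (ennreal a) (restr_to_subalg R F)"
  have sets: "sets p = sets F" "sets q = sets F" "sets r = sets F"
    using sub by (simp_all add: p_def q_def r_def sets_restr_to_subalg)
  have sum: "emeasure p A = emeasure q A + emeasure r A" if "A \<in> sets F" for A
    using mixture_onD[OF mix that] that sub a
    by (simp add: p_def q_def r_def emeasure_restr_to_subalg P.emeasure_eq_measure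
        Q.emeasure_eq_measure R.emeasure_eq_measure ennreal_mult[symmetric] ennreal_plus[symmetric]
        del: ennreal_plus)
  have "finite_measure p" 
  proof
    show "emeasure p (space p) \<noteq> \<infinity>"
      using sub(1) sets.top[of F] P.emeasure_finite
      by (simp add: p_def space_restr_to_subalg emeasure_restr_to_subalg subalgebra_def)
  qed
  then interpret p: finite_measure p .
  have "absolutely_continuous p q" "absolutely_continuous p r"
    unfolding absolutely_continuous_def using sum by (auto simp: null_sets_def sets)
  then obtain d e where d: "d \<in> borel_measurable p" "density p d = q"
    and e: "e \<in> borel_measurable p" "density p e = r"
    using p.Radon_Nikodym sets by metis
  \<comment> \<open>Uniqueness of densities: \<open>d + e\<close> and the constant \<open>1\<close>
    both represent \<open>p\<close> with respect to itself.\<close>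
  have "AE x in p. d x + e x = 1"
  proof (rule p.density_unique)
    show "density p (\<lambda>x. d x + e x) = density p (\<lambda>_. 1)"
    proof (rule measure_eqI)
      fix A assume "A \<in> sets (density p (\<lambda>x. d x + e x))"
      then have A: "A \<in> sets p" by simp
      have "emeasure (density p (\<lambda>x. d x + e x)) A = emeasure (density p d) A + emeasure (density p e) A"
        using A d(1) e(1) by (simp add: emeasure_density nn_integral_add[symmetric] distrib_right)
      also have "\<dots> = emeasure p A" unfolding d(2) e(2) using A sum by (simp add: sets)
      finally show "emeasure (density p (\<lambda>x. d x + e x)) A = emeasure (density p (\<lambda>_. 1)) A"
        using A by (simp add: emeasure_density)
    qed simp
  qed (use d e in auto)
  then have AE: "AE x in p. d x = ennreal (min 1 (enn2real (d x))) \<and> e x = ennreal (1 - min 1 (enn2real (d x)))"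
  proof eventually_elim
    case (elim x)
    then have le: "d x \<le> 1" by (metis add_increasing2 order_refl zero_le order_eq_refl)
    then obtain u where u: "d x = ennreal u" "0 \<le> u" "u \<le> 1"
      by (cases "d x") (auto simp: ennreal_le_1 top_unique)
    have "e x = 1 - d x" using elim le by (metis ennreal_add_diff_cancel_left ennreal_one_neq_top le neq_top_trans)
    then show ?case using u by (simp add: ennreal_minus min_absorb2 ennreal_1[symmetric] del: ennreal_1)
  qed
  \<comment> \<open>Truncation changes \<open>d\<close> only on a null set, and makes
    \<open>D\<close> a weight in \<open>[0,1]\<close> at every point.\<close>
  define D where "D x = min 1 (enn2real (d x))" for x
  have DF: "D \<in> borel_measurable F"
  proof -
    have [measurable]: "d \<in> borel_measurable F" using d(1) measurable_cong_sets[OF sets(1) refl] by auto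
    have "(\<lambda>x. enn2real (d x)) \<in> borel_measurable F" by measurable
    then show ?thesis
      unfolding D_def[abs_def] by (intro borel_measurable_min borel_measurable_const)
  qed
  show ?thesis
  proof (rule that[OF DF], safe)
    fix f :: "'a \<Rightarrow> ennreal" assume f: "f \<in> borel_measurable F"
    then have fp: "f \<in> borel_measurable p" "f \<in> borel_measurable q" "f \<in> borel_measurable r"
      using f by (auto intro: measurable_sets_eq_cong[OF sets(1)] measurable_sets_eq_cong[OF sets(2)]
        measurable_sets_eq_cong[OF sets(3)])
    have fr: "f \<in> borel_measurable (restr_to_subalg Q F)" "f \<in> borel_measurable (restr_to_subalg R F)"
      using f sub by (auto intro: measurable_in_subalg)
    have "(\<integral>\<^sup>+x. ennreal (D x) * f x \<partial>P) = (\<integral>\<^sup>+x. ennreal (D x) * f x \<partial>p)"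
      unfolding p_def using sub(1) f DF by (subst nn_integral_subalgebra2) auto
    also have "\<dots> = (\<integral>\<^sup>+x. d x * f x \<partial>p)"
      by (rule nn_integral_cong_AE) (use AE in eventually_elim, simp add: D_def)
    also have "\<dots> = (\<integral>\<^sup>+x. f x \<partial>q)" using d fp by (simp add: nn_integral_density[symmetric])
    also have "\<dots> = ennreal (1 - a) * (\<integral>\<^sup>+x. f x \<partial>Q)"
      unfolding q_def nn_integral_scale_measure[OF fr(1)] using sub f by (simp add: nn_integral_subalgebra2)
    finally show "(\<integral>\<^sup>+x. ennreal (D x) * f x \<partial>P) = ennreal (1 - a) * (\<integral>\<^sup>+x. f x \<partial>Q)" .
    have "(\<integral>\<^sup>+x. ennreal (1 - D x) * f x \<partial>P) = (\<integral>\<^sup>+x. ennreal (1 - D x) * f x \<partial>p)"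
      unfolding p_def using sub(1) f DF by (subst nn_integral_subalgebra2) auto
    also have "\<dots> = (\<integral>\<^sup>+x. e x * f x \<partial>p)"
      by (rule nn_integral_cong_AE) (use AE in eventually_elim, simp add: D_def)
    also have "\<dots> = (\<integral>\<^sup>+x. f x \<partial>r)" using e fp by (simp add: nn_integral_density[symmetric])
    also have "\<dots> = ennreal a * (\<integral>\<^sup>+x. f x \<partial>R)"
      unfolding r_def nn_integral_scale_measure[OF fr(2)] using sub f by (simp add: nn_integral_subalgebra2)
    finally show "(\<integral>\<^sup>+x. ennreal (1 - D x) * f x \<partial>P) = ennreal a * (\<integral>\<^sup>+x. f x \<partial>R)" .
  qed (auto simp: D_def)
qed

text \<open>The identity on events extends to nonnegative functions by splitting the integrand with
  the weights \<open>D\<close> and \<open>1 - D\<close>.\<close>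

lemma mixture_nn_integral:
  assumes P: "prob_space P" and Q: "prob_space Q" and R: "prob_space R"
    and sub: "subalgebra P F" "subalgebra Q F" "subalgebra R F"
    and mix: "mixture_on a P Q R (sets F)" and a: "0 \<le> a" "a \<le> 1"
    and f: "f \<in> borel_measurable F"
  shows "(\<integral>\<^sup>+x. f x \<partial>P) = ennreal (1 - a) * (\<integral>\<^sup>+x. f x \<partial>Q) + ennreal a * (\<integral>\<^sup>+x. f x \<partial>R)"
proof -
  obtain D :: "'a \<Rightarrow> real" where D': "D \<in> borel_measurable F" "\<forall>x. 0 \<le> D x \<and> D x \<le> 1"
    "\<forall>f\<in>borel_measurable F. (\<integral>\<^sup>+x. ennreal (D x) * f x \<partial>P) = ennreal (1 - a) * (\<integral>\<^sup>+x. f x \<partial>Q)"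
    "\<forall>f\<in>borel_measurable F. (\<integral>\<^sup>+x. ennreal (1 - D x) * f x \<partial>P) = ennreal a * (\<integral>\<^sup>+x. f x \<partial>R)"
    by (rule mixture_density[OF P Q R sub mix a])
  note D = D'(1) D'(2)[rule_format, THEN conjunct1] D'(2)[rule_format, THEN conjunct2]
    D'(3)[rule_format] D'(4)[rule_format]
  have [measurable]: "D \<in> borel_measurable P" "f \<in> borel_measurable P"
    using D(1) f sub(1) by (auto intro: measurable_from_subalg)
  have "f x = ennreal (D x) * f x + ennreal (1 - D x) * f x" for x
    using D(2,3)[of x] by (simp add: distrib_right[symmetric] ennreal_plus[symmetric] del: ennreal_plus)
  then have "(\<integral>\<^sup>+x. f x \<partial>P) = (\<integral>\<^sup>+x. ennreal (D x) * f x + ennreal (1 - D x) * f x \<partial>P)"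
    by (intro nn_integral_cong)
  also have "\<dots> = (\<integral>\<^sup>+x. ennreal (D x) * f x \<partial>P) + (\<integral>\<^sup>+x. ennreal (1 - D x) * f x \<partial>P)"
    by (rule nn_integral_add) auto
  finally show ?thesis unfolding D(4)[OF f] D(5)[OF f] .
qed

text \<open>Conditional expectations of \<open>Y\<close> lie in \<open>[0,1]\<close> only almost
  everywhere. Clipped versions lie there everywhere, so concavity on the interval can be used
  pointwise.\<close>

definition clip :: "real \<Rightarrow> real" where "clip x = max 0 (min 1 x)"

lemma clip_bounds: "0 \<le> clip x" "clip x \<le> 1"
  by (auto simp: clip_def)

lemma clip_id: "0 \<le> x \<Longrightarrow> x \<le> 1 \<Longrightarrow> clip x = x"
  by (auto simp: clip_def)

lemma measurable_clip[measurable]: "f \<in> borel_measurable M \<Longrightarrow> (\<lambda>x. clip (f x)) \<in> borel_measurable M"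
  unfolding clip_def by (intro borel_measurable_max borel_measurable_min borel_measurable_const)

lemma cond_exp_unit_interval:
  assumes "prob_space M" "subalgebra M G" "integrable M y" "\<And>x. x \<in> space M \<Longrightarrow> 0 \<le> y x \<and> y x \<le> 1"
  shows "AE x in M. 0 \<le> real_cond_exp M G y x \<and> real_cond_exp M G y x \<le> 1"
proof -
  interpret prob_space M by fact
  interpret finite_measure_subalgebra M G by standard fact
  have "AE x in M. real_cond_exp M G y x \<ge> 0" "AE x in M. real_cond_exp M G y x \<le> 1"
    using assms(4) by (auto intro!: real_cond_exp_ge_c[OF assms(3)] real_cond_exp_le_c[OF assms(3)])
  then show ?thesis by eventually_elim simp
qed

text \<open>The defining property of a conditional expectation, recast with nonnegative integrals
  because the weights of \<open>mixture_density\<close> are characterised through those.\<close>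

lemma nn_integral_clip_cond_exp:
  assumes M: "prob_space M" and G: "subalgebra M G" and y: "integrable M y"
    and b: "\<And>x. x \<in> space M \<Longrightarrow> 0 \<le> y x \<and> y x \<le> 1" and A: "A \<in> sets G"
  shows "(\<integral>\<^sup>+x. ennreal (indicator A x * clip (real_cond_exp M G y x)) \<partial>M) =
    (\<integral>\<^sup>+x. ennreal (indicator A x * y x) \<partial>M)"
proof -
  interpret prob_space M by fact
  interpret finite_measure_subalgebra M G by standard fact
  have AM: "A \<in> sets M" using A G by (auto simp: subalgebra_def)
  have AE: "AE x in M. 0 \<le> real_cond_exp M G y x \<and> real_cond_exp M G y x \<le> 1"
    using b by (rule cond_exp_unit_interval[OF M G y])
  let ?c = "real_cond_exp M G y"
  have "(\<integral>\<^sup>+x. ennreal (indicator A x * clip (?c x)) \<partial>M) = (\<integral>\<^sup>+x. ennreal (indicator A x * ?c x) \<partial>M)"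
    by (rule nn_integral_cong_AE) (use AE in eventually_elim, simp add: clip_id)
  also have "\<dots> = ennreal (\<integral>x. indicator A x * ?c x \<partial>M)"
  proof (rule nn_integral_eq_integral)
    show "integrable M (\<lambda>x. indicator A x * ?c x)"
      using integrable_mult_indicator[OF AM real_cond_exp_int(1)[OF y]] by simp
    show "AE x in M. 0 \<le> indicator A x * ?c x" using AE by eventually_elim simp
  qed
  also have "(\<integral>x. indicator A x * ?c x \<partial>M) = (\<integral>x. indicator A x * y x \<partial>M)"
    using real_cond_exp_intA[OF y A] by (simp add: set_lebesgue_integral_def)
  also have "ennreal \<dots> = (\<integral>\<^sup>+x. ennreal (indicator A x * y x) \<partial>M)"
  proof (rule nn_integral_eq_integral[symmetric])
    show "integrable M (\<lambda>x. indicator A x * y x)"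
      using integrable_mult_indicator[OF AM y] by simp
    show "AE x in M. 0 \<le> indicator A x * y x" using b by (intro AE_I2) auto
  qed
  finally show ?thesis .
qed

text \<open>With \<^term>\<open>D\<close> the density of the part of \<^term>\<open>P\<close> coming from \<^term>\<open>Q\<close>, the posterior under
  the mixture is the average of the two posteriors with the random weights \<^term>\<open>D\<close> and
  \<^term>\<open>1 - D\<close>, so that concavity can be applied pointwise.\<close>

lemma nn_integral_cond_exp_concave:
  fixes k :: "real \<Rightarrow> 'a \<Rightarrow> real"
  assumes P: "prob_space P" and Q: "prob_space Q" and R: "prob_space R"
    and G: "subalgebra P G" "subalgebra Q G" "subalgebra R G"
    and F: "subalgebra P F" "subalgebra Q F" "subalgebra R F" and GF: "sets G \<subseteq> sets F"
    and mix: "mixture_on a P Q R (sets F)" and a: "0 \<le> a" "a \<le> 1"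
    and y: "y \<in> borel_measurable F" "\<And>x. x \<in> space P \<Longrightarrow> 0 \<le> y x \<and> y x \<le> 1"
    and k_meas: "\<And>c. c \<in> borel_measurable G \<Longrightarrow> (\<lambda>\<omega>. k (c \<omega>) \<omega>) \<in> borel_measurable G"
    and k_nonneg: "\<And>c \<omega>. 0 \<le> k c \<omega>"
    and k_concave: "\<And>u v w \<omega>. u \<in> {0..1} \<Longrightarrow> v \<in> {0..1} \<Longrightarrow> w \<in> {0..1} \<Longrightarrow>
      w * k u \<omega> + (1 - w) * k v \<omega> \<le> k (w * u + (1 - w) * v) \<omega>"
    and B: "B \<in> sets G"
  shows "ennreal (1 - a) * (\<integral>\<^sup>+\<omega>. indicator B \<omega> * ennreal (k (real_cond_exp Q G y \<omega>) \<omega>) \<partial>Q) +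
      ennreal a * (\<integral>\<^sup>+\<omega>. indicator B \<omega> * ennreal (k (real_cond_exp R G y \<omega>) \<omega>) \<partial>R) \<le>
    (\<integral>\<^sup>+\<omega>. indicator B \<omega> * ennreal (k (real_cond_exp P G y \<omega>) \<omega>) \<partial>P)"
proof -
  interpret P: prob_space P by fact
  interpret Q: prob_space Q by fact
  interpret R: prob_space R by fact
  interpret PG: finite_measure_subalgebra P G by standard fact
  have sp: "space Q = space P" "space R = space P"
    using G by (auto simp: subalgebra_def)
  have spG: "space G = space P" using G by (auto simp: subalgebra_def)
  have yM: "y \<in> borel_measurable P" "y \<in> borel_measurable Q" "y \<in> borel_measurable R"
    using y(1) F by (auto intro: measurable_from_subalg)
  have int: "integrable P y" "integrable Q y" "integrable R y"
    using yM y(2) sp by (auto intro!: AE_abs_le_integrable[where c=1] AE_I2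
        simp: P.finite_measure_axioms Q.finite_measure_axioms R.finite_measure_axioms)
  have mixG: "mixture_on a P Q R (sets G)" using mix GF by (auto simp: mixture_on_def)
  \<comment> \<open>The weight is taken on \<open>G\<close>, not on the larger \<open>F\<close>: the
    averaged posterior has to be a function of the observations.\<close>
  obtain D :: "'a \<Rightarrow> real" where D': "D \<in> borel_measurable G" "\<forall>x. 0 \<le> D x \<and> D x \<le> 1"
    "\<forall>f\<in>borel_measurable G. (\<integral>\<^sup>+x. ennreal (D x) * f x \<partial>P) = ennreal (1 - a) * (\<integral>\<^sup>+x. f x \<partial>Q)"
    "\<forall>f\<in>borel_measurable G. (\<integral>\<^sup>+x. ennreal (1 - D x) * f x \<partial>P) = ennreal a * (\<integral>\<^sup>+x. f x \<partial>R)"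
    by (rule mixture_density[OF P Q R G mixG a])
  note D = D'(1) D'(2)[rule_format, THEN conjunct1] D'(2)[rule_format, THEN conjunct2]
    D'(3)[rule_format] D'(4)[rule_format]
  define q where "q \<omega> = clip (real_cond_exp Q G y \<omega>)" for \<omega>
  define r where "r \<omega> = clip (real_cond_exp R G y \<omega>)" for \<omega>
  define m where "m \<omega> = D \<omega> * q \<omega> + (1 - D \<omega>) * r \<omega>" for \<omega>
  have [measurable]: "q \<in> borel_measurable G" "r \<in> borel_measurable G" "D \<in> borel_measurable G"
    unfolding q_def[abs_def] r_def[abs_def] using D(1) by (auto intro!: measurable_clip)
  have mG[measurable]: "m \<in> borel_measurable G" unfolding m_def[abs_def] by measurable
  have qr: "0 \<le> q \<omega>" "q \<omega> \<le> 1" "0 \<le> r \<omega>" "r \<omega> \<le> 1" for \<omega>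
    by (auto simp: q_def r_def clip_bounds)
  have m01: "0 \<le> m \<omega>" "m \<omega> \<le> 1" for \<omega>
  proof -
    show "0 \<le> m \<omega>" using D(2,3)[of \<omega>] qr by (simp add: m_def)
    have "m \<omega> \<le> D \<omega> * 1 + (1 - D \<omega>) * 1"
      unfolding m_def using D(2,3)[of \<omega>] qr by (intro add_mono mult_left_mono) auto
    then show "m \<omega> \<le> 1" by simp
  qed
  have mP: "m \<in> borel_measurable P" using G(1) mG by (rule measurable_from_subalg)
  have intm: "integrable P m"
    using mP m01 by (auto intro!: AE_abs_le_integrable[where c=1] AE_I2 simp: P.finite_measure_axioms)
  \<comment> \<open>Bayes' rule for the mixture. Over an event of \<open>G\<close>,
    \<open>D * q\<close> integrates under \<open>P\<close> to \<open>1 - a\<close> times the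
    \<open>Q\<close>-integral of \<open>y\<close>, and \<open>(1 - D) * r\<close> to
    \<open>a\<close> times its \<open>R\<close>-integral. The mixture identity on \<open>F\<close>,
    where \<open>y\<close> is measurable, adds these up to the \<open>P\<close>-integral of
    \<open>y\<close>.\<close>
  have cond: "AE \<omega> in P. real_cond_exp P G y \<omega> = m \<omega>"
  proof (rule PG.real_cond_exp_charact[OF _ int(1) intm mG])
    fix A assume A: "A \<in> sets G"
    then have [measurable]: "A \<in> sets G" "A \<in> sets P" "A \<in> sets F" using G GF by (auto simp: subalgebra_def)
    have "(\<integral>\<^sup>+\<omega>. ennreal (indicator A \<omega> * m \<omega>) \<partial>P) =
      (\<integral>\<^sup>+\<omega>. ennreal (D \<omega>) * ennreal (indicator A \<omega> * q \<omega>) + ennreal (1 - D \<omega>) * ennreal (indicator A \<omega> * r \<omega>) \<partial>P)"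
      using D(2,3) qr
      by (intro nn_integral_cong)
        (simp add: m_def ennreal_mult ennreal_plus split: split_indicator)
    also have "\<dots> = (\<integral>\<^sup>+\<omega>. ennreal (D \<omega>) * ennreal (indicator A \<omega> * q \<omega>) \<partial>P) +
        (\<integral>\<^sup>+\<omega>. ennreal (1 - D \<omega>) * ennreal (indicator A \<omega> * r \<omega>) \<partial>P)"
      by (intro nn_integral_add measurable_from_subalg[OF G(1)]) measurable
    also have "\<dots> = ennreal (1 - a) * (\<integral>\<^sup>+\<omega>. ennreal (indicator A \<omega> * q \<omega>) \<partial>Q) +
        ennreal a * (\<integral>\<^sup>+\<omega>. ennreal (indicator A \<omega> * r \<omega>) \<partial>R)"
    proof -
      have "(\<lambda>\<omega>. ennreal (indicator A \<omega> * q \<omega>)) \<in> borel_measurable G"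
        "(\<lambda>\<omega>. ennreal (indicator A \<omega> * r \<omega>)) \<in> borel_measurable G" by measurable
      then show ?thesis by (simp only: D(4,5))
    qed
    also have "\<dots> = ennreal (1 - a) * (\<integral>\<^sup>+\<omega>. ennreal (indicator A \<omega> * y \<omega>) \<partial>Q) +
        ennreal a * (\<integral>\<^sup>+\<omega>. ennreal (indicator A \<omega> * y \<omega>) \<partial>R)"
      unfolding q_def r_def
      using nn_integral_clip_cond_exp[OF Q G(2) int(2) _ A] nn_integral_clip_cond_exp[OF R G(3) int(3) _ A]
        y(2) sp by simp
    also have "\<dots> = (\<integral>\<^sup>+\<omega>. ennreal (indicator A \<omega> * y \<omega>) \<partial>P)"
      using y(1) by (intro mixture_nn_integral[OF P Q R F mix a, symmetric]) measurable
    finally have eq: "(\<integral>\<^sup>+\<omega>. ennreal (indicator A \<omega> * m \<omega>) \<partial>P) = (\<integral>\<^sup>+\<omega>. ennreal (indicator A \<omega> * y \<omega>) \<partial>P)" .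
    have "(\<integral>\<omega>. indicator A \<omega> * y \<omega> \<partial>P) = (\<integral>\<omega>. indicator A \<omega> * m \<omega> \<partial>P)"
      using mP yM m01 y(2)
      by (subst integral_eq_nn_integral) (auto intro!: AE_I2 simp: eq integral_eq_nn_integral)
    then show "(LINT \<omega>:A|P. y \<omega>) = (LINT \<omega>:A|P. m \<omega>)" by (simp add: set_lebesgue_integral_def)
  qed
  note kq = k_meas[of q] and kr = k_meas[of r]
  have kB: "(\<lambda>\<omega>. indicator B \<omega> * ennreal (k (q \<omega>) \<omega>)) \<in> borel_measurable G"
    "(\<lambda>\<omega>. indicator B \<omega> * ennreal (k (r \<omega>) \<omega>)) \<in> borel_measurable G"
    using kq kr B by (auto intro!: borel_measurable_times borel_measurable_indicator)
  have AQ: "AE \<omega> in Q. real_cond_exp Q G y \<omega> = q \<omega>"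
    using cond_exp_unit_interval[OF Q G(2) int(2)] y(2) sp by (auto simp: q_def clip_id)
  have AR: "AE \<omega> in R. real_cond_exp R G y \<omega> = r \<omega>"
    using cond_exp_unit_interval[OF R G(3) int(3)] y(2) sp by (auto simp: r_def clip_id)
  have "ennreal (1 - a) * (\<integral>\<^sup>+\<omega>. indicator B \<omega> * ennreal (k (real_cond_exp Q G y \<omega>) \<omega>) \<partial>Q) +
      ennreal a * (\<integral>\<^sup>+\<omega>. indicator B \<omega> * ennreal (k (real_cond_exp R G y \<omega>) \<omega>) \<partial>R) =
    ennreal (1 - a) * (\<integral>\<^sup>+\<omega>. indicator B \<omega> * ennreal (k (q \<omega>) \<omega>) \<partial>Q) +
      ennreal a * (\<integral>\<^sup>+\<omega>. indicator B \<omega> * ennreal (k (r \<omega>) \<omega>) \<partial>R)"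
    using AQ AR by (intro arg_cong2[where f="(+)"] arg_cong2[where f="(*)"] refl nn_integral_cong_AE) auto
  also have "\<dots> = (\<integral>\<^sup>+\<omega>. ennreal (D \<omega>) * (indicator B \<omega> * ennreal (k (q \<omega>) \<omega>)) \<partial>P) +
      (\<integral>\<^sup>+\<omega>. ennreal (1 - D \<omega>) * (indicator B \<omega> * ennreal (k (r \<omega>) \<omega>)) \<partial>P)"
    unfolding D(4)[OF kB(1)] D(5)[OF kB(2)] ..
  also have "\<dots> = (\<integral>\<^sup>+\<omega>. ennreal (D \<omega>) * (indicator B \<omega> * ennreal (k (q \<omega>) \<omega>)) +
      ennreal (1 - D \<omega>) * (indicator B \<omega> * ennreal (k (r \<omega>) \<omega>)) \<partial>P)"
  proof (rule nn_integral_add[symmetric])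
    have "(\<lambda>\<omega>. ennreal (D \<omega>) * (indicator B \<omega> * ennreal (k (q \<omega>) \<omega>))) \<in> borel_measurable G"
      "(\<lambda>\<omega>. ennreal (1 - D \<omega>) * (indicator B \<omega> * ennreal (k (r \<omega>) \<omega>))) \<in> borel_measurable G"
      using kB D(1) by measurable
    then show "(\<lambda>\<omega>. ennreal (D \<omega>) * (indicator B \<omega> * ennreal (k (q \<omega>) \<omega>))) \<in> borel_measurable P"
      "(\<lambda>\<omega>. ennreal (1 - D \<omega>) * (indicator B \<omega> * ennreal (k (r \<omega>) \<omega>))) \<in> borel_measurable P"
      using G(1) by (auto intro: measurable_from_subalg)
  qed
  also have "\<dots> \<le> (\<integral>\<^sup>+\<omega>. indicator B \<omega> * ennreal (k (m \<omega>) \<omega>) \<partial>P)"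
  proof (rule nn_integral_mono)
    fix \<omega>
    have "ennreal (D \<omega>) * ennreal (k (q \<omega>) \<omega>) + ennreal (1 - D \<omega>) * ennreal (k (r \<omega>) \<omega>) =
        ennreal (D \<omega> * k (q \<omega>) \<omega> + (1 - D \<omega>) * k (r \<omega>) \<omega>)"
      using D(2,3)[of \<omega>] k_nonneg by (simp add: ennreal_mult ennreal_plus)
    also have "\<dots> \<le> ennreal (k (m \<omega>) \<omega>)"
      unfolding m_def using D(2,3)[of \<omega>] qr[of \<omega>] by (intro ennreal_leI k_concave) auto
    finally show "ennreal (D \<omega>) * (indicator B \<omega> * ennreal (k (q \<omega>) \<omega>)) +
      ennreal (1 - D \<omega>) * (indicator B \<omega> * ennreal (k (r \<omega>) \<omega>)) \<le> indicator B \<omega> * ennreal (k (m \<omega>) \<omega>)"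
      by (simp split: split_indicator)
  qed
  also have "\<dots> = (\<integral>\<^sup>+\<omega>. indicator B \<omega> * ennreal (k (real_cond_exp P G y \<omega>) \<omega>) \<partial>P)"
    using cond by (intro nn_integral_cong_AE) auto
  finally show ?thesis .
qed

section \<open>Posteriors under a mixed prior\<close>

text \<open>Composing a cost with this retraction onto the cube extends it continuously to the whole
  space; nothing is assumed about the costs outside the cube.\<close>

definition clip_vec :: "real^'n \<Rightarrow> real^'n" where "clip_vec v = (\<chi> j. clip (v $ j))"

lemma clip_vec_in_cube: "clip_vec v \<in> unit_cube"
  by (simp add: clip_vec_def unit_cube_def clip_bounds)

lemma clip_vec_id: "v \<in> unit_cube \<Longrightarrow> clip_vec v = v"
  by (simp add: clip_vec_def unit_cube_def clip_id vec_eq_iff)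

lemma continuous_on_clip_vec: "continuous_on S (clip_vec :: real^'n::finite \<Rightarrow> real^'n)"
  unfolding clip_vec_def[abs_def] clip_def by (intro continuous_intros)

lemma continuous_clip_vec_compose:
  fixes g :: "real^'n::finite \<Rightarrow> real"
  assumes "continuous_on unit_cube g"
  shows "continuous_on UNIV (\<lambda>v. g (clip_vec v))"
  by (rule continuous_on_compose2[OF assms continuous_on_clip_vec]) (auto simp: clip_vec_in_cube)

lemma measurable_clip_vec_compose:
  fixes g :: "real^'n::finite \<Rightarrow> real"
  assumes "continuous_on unit_cube g" "f \<in> borel_measurable M"
  shows "(\<lambda>\<omega>. g (clip_vec (f \<omega>))) \<in> borel_measurable M"
  using measurable_compose[OF assms(2) borel_measurable_continuous_onI[OF continuous_clip_vec_compose[OF assms(1)]]] .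

locale observed_posterior = obs_model \<mu> lam \<pi> M Y W X
  for \<mu> lam :: "'n::finite \<Rightarrow> real" and \<pi> and M :: "'a measure" and Y W X +
  fixes Post :: "real \<Rightarrow> 'a \<Rightarrow> real^'n"
  assumes posterior: "posterior_process M Y X Post"
begin

lemma measurable_Post: "0 \<le> t \<Longrightarrow> Post t \<in> borel_measurable M"
  using posterior by (simp add: posterior_process_def)

lemma Post_continuous: "AE \<omega> in M. continuous_on {0..} (\<lambda>t. Post t \<omega>)"
  using posterior by (simp add: posterior_process_def)

lemma Post_cond_exp:
  assumes "0 \<le> t"
  shows "AE \<omega> in M. \<forall>i. Post t \<omega> $ i = real_cond_exp M (natural_filtration (space M) X (ennreal t)) (Y i t) \<omega>"
  using posterior assms by (intro AE_all_countable[THEN iffD2]) (simp add: posterior_process_def)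

lemma Y_bounds: "0 \<le> t \<Longrightarrow> \<omega> \<in> space M \<Longrightarrow> 0 \<le> Y i t \<omega> \<and> Y i t \<omega> \<le> 1"
  using Y_values[of t \<omega> i] by auto

lemma cond_exp_Y_bounds:
  assumes "0 \<le> t" "subalgebra M G"
  shows "AE \<omega> in M. \<forall>i. 0 \<le> real_cond_exp M G (Y i t) \<omega> \<and> real_cond_exp M G (Y i t) \<omega> \<le> 1"
  using assms Y_bounds integrable_Y
  by (intro AE_all_countable[THEN iffD2] allI cond_exp_unit_interval) (auto simp: prob_space_axioms)

lemma Post_in_cube:
  assumes "0 \<le> t" shows "AE \<omega> in M. Post t \<omega> \<in> unit_cube"
  using Post_cond_exp[OF assms] cond_exp_Y_bounds[OF assms subalgebra_natural[of "ennreal t"]]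
  by eventually_elim (simp add: unit_cube_def)

text \<open>Only coordinate \<open>i\<close> is computed under the measure at hand; the others use
  versions from the reference measure \<open>P\<close>. Applied to three measures with the same
  \<open>P\<close>, it puts their posteriors into one form that differs in a single entry.\<close>

lemma Post_eq:
  assumes P: "obs_model \<mu> lam \<pi>' P Y W X" and sets: "sets P = sets M" and t: "0 \<le> t"
    and other: "\<And>j. j \<noteq> i \<Longrightarrow> \<pi>' $ j = \<pi> $ j"
  shows "AE \<omega> in M. Post t \<omega> = clip_vec (\<chi> j.
    if j = i then real_cond_exp M (natural_filtration (space P) X (ennreal t)) (Y i t) \<omega>
    else real_cond_exp P (coord_filtration (space P) X (ennreal t) j) (Y j t) \<omega>)"
proof -
  have sp: "space P = space M" using sets by (rule sets_eq_imp_space_eq)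
  have "AE \<omega> in M. \<forall>j. j \<noteq> i \<longrightarrow> real_cond_exp M (natural_filtration (space P) X (ennreal t)) (Y j t) \<omega> =
    real_cond_exp P (coord_filtration (space P) X (ennreal t) j) (Y j t) \<omega>"
    using posterior_coordinate[OF P obs_model_axioms sets[symmetric] other t]
    by (intro AE_all_countable[THEN iffD2] allI) simp
  with Post_cond_exp[OF t] Post_in_cube[OF t] show ?thesis
  proof eventually_elim
    case (elim \<omega>)
    have "Post t \<omega> = (\<chi> j.
      if j = i then real_cond_exp M (natural_filtration (space P) X (ennreal t)) (Y i t) \<omega>
      else real_cond_exp P (coord_filtration (space P) X (ennreal t) j) (Y j t) \<omega>)"
      using elim(1,3) sp by (simp add: vec_eq_iff)
    moreover have "Post t \<omega> = clip_vec (Post t \<omega>)" using elim(2) by (simp add: clip_vec_id)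
    ultimately show ?case by metis
  qed
qed

end

text \<open>\<open>P\<close> belongs to the intermediate prior, \<open>Q\<close> and
  \<open>R\<close> to the end points. The strict bounds on \<open>a\<close> make events of
  \<open>obs_total\<close> that are null for \<open>P\<close> null for \<open>Q\<close> and
  \<open>R\<close> too.\<close>

locale mixed_posteriors =
  P: observed_posterior \<mu> lam \<pi> P Y W X PP +
  Q: observed_posterior \<mu> lam \<pi>' Q Y W X QP +
  R: observed_posterior \<mu> lam \<pi>'' R Y W X RP
  for \<mu> lam :: "'n::finite \<Rightarrow> real" and \<pi> \<pi>' \<pi>'' and P Q R :: "'a measure" and Y W X PP QP RP +
  fixes a :: real and i :: 'n
  assumes sets: "sets Q = sets P" "sets R = sets P"
    and a: "0 < a" "a < 1"
    and coord: "\<pi> $ i = (1 - a) * \<pi>' $ i + a * \<pi>'' $ i"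
    and other: "\<And>j. j \<noteq> i \<Longrightarrow> \<pi>' $ j = \<pi> $ j" "\<And>j. j \<noteq> i \<Longrightarrow> \<pi>'' $ j = \<pi> $ j"
begin

lemma spaces: "space Q = space P" "space R = space P"
  using sets by (auto dest: sets_eq_imp_space_eq)

lemma mixture: "mixture_on a P Q R (sets (obs_total Y X (space P)))"
  by (rule obs_total_mixture[OF P.obs_model_axioms Q.obs_model_axioms R.obs_model_axioms sets coord other])

text \<open>The event \<open>B\<close> makes room for both uses: a cell of the rounded stopping time
  in the terminal cost, and the event of not having stopped before \<open>t\<close> in the running
  cost.\<close>

lemma fixed_time_concave:
  assumes g: "continuous_on unit_cube g" "\<forall>v\<in>unit_cube. 0 \<le> g v" "concave_in_each_variable g"
    and t: "0 \<le> t" and B: "B \<in> sets (natural_filtration (space P) X (ennreal t))"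
  shows "ennreal (1 - a) * (\<integral>\<^sup>+\<omega>. indicator B \<omega> * ennreal (g (QP t \<omega>)) \<partial>Q) +
      ennreal a * (\<integral>\<^sup>+\<omega>. indicator B \<omega> * ennreal (g (RP t \<omega>)) \<partial>R) \<le>
    (\<integral>\<^sup>+\<omega>. indicator B \<omega> * ennreal (g (PP t \<omega>)) \<partial>P)"
proof -
  let ?G = "natural_filtration (space P) X (ennreal t)"
  let ?F = "obs_total Y X (space P)"
  define \<phi> where "\<phi> j = real_cond_exp P (coord_filtration (space P) X (ennreal t) j) (Y j t)" for j
  \<comment> \<open>The cost as a function of posterior \<open>i\<close> alone. The remaining
    posteriors are frozen at versions shared by the three measures and measurable for the
    observations, so concavity in one variable is all that is applied.\<close>
  define k where "k c \<omega> = g (clip_vec (\<chi> j. if j = i then c else \<phi> j \<omega>))" for c \<omega>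
  have G: "subalgebra P ?G" "subalgebra Q ?G" "subalgebra R ?G"
    using P.subalgebra_natural[of "ennreal t"] Q.subalgebra_natural[of "ennreal t"]
      R.subalgebra_natural[of "ennreal t"] spaces by simp_all
  have F: "subalgebra P ?F" "subalgebra Q ?F" "subalgebra R ?F"
    using P.obs_total_subset Q.obs_total_subset R.obs_total_subset spaces by (simp_all add: subalgebra_def)
  have \<phi>G: "\<phi> j \<in> borel_measurable ?G" for j
    unfolding \<phi>_def using borel_measurable_cond_exp
    by (rule measurable_from_subalg[rotated]) (simp add: subalgebra_def coord_filtration_subset)
  have k_meas: "(\<lambda>\<omega>. k (c \<omega>) \<omega>) \<in> borel_measurable ?G" if c: "c \<in> borel_measurable ?G" for c
    unfolding k_def
  proof (rule measurable_clip_vec_compose[OF g(1)], rule measurable_vecI)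
    fix j show "(\<lambda>\<omega>. (\<chi> j. if j = i then c \<omega> else \<phi> j \<omega>) $ j) \<in> borel_measurable ?G"
      using c \<phi>G[of j] by (cases "j = i") simp_all
  qed
  have k_concave: "w * k u \<omega> + (1 - w) * k v \<omega> \<le> k (w * u + (1 - w) * v) \<omega>"
    if uvw: "u \<in> {0..1}" "v \<in> {0..1}" "w \<in> {0..1}" for u v w \<omega>
  proof -
    let ?\<psi> = "clip_vec (\<chi> j. \<phi> j \<omega>)"
    have eq: "k c \<omega> = g (\<chi> j. if j = i then c else ?\<psi> $ j)" if "c \<in> {0..1}" for c
      unfolding k_def using that
      by (intro arg_cong[where f=g]) (simp add: vec_eq_iff clip_vec_def clip_id)
    have conc: "concave_on {0..1} (\<lambda>x. g (\<chi> j. if j = i then x else ?\<psi> $ j))"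
      using g(3) clip_vec_in_cube unfolding concave_in_each_variable_def by blast
    have "w * u + (1 - w) * v \<in> {0..1}"
      using convexD[of "{0..1::real}" u v w "1 - w"] uvw by simp
    \<comment> \<open>\<open>concave_onD\<close> attaches its parameter to the second point, hence
      the instance \<open>1 - w\<close>.\<close>
    then show ?thesis
      using concave_onD[OF conc, of "1 - w" u v, unfolded diff_diff_eq2 add_diff_cancel_left' real_scaleR_def] uvw
      by (simp add: eq)
  qed
  have "ennreal (1 - a) * (\<integral>\<^sup>+\<omega>. indicator B \<omega> * ennreal (k (real_cond_exp Q ?G (Y i t) \<omega>) \<omega>) \<partial>Q) +
      ennreal a * (\<integral>\<^sup>+\<omega>. indicator B \<omega> * ennreal (k (real_cond_exp R ?G (Y i t) \<omega>) \<omega>) \<partial>R) \<le>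
    (\<integral>\<^sup>+\<omega>. indicator B \<omega> * ennreal (k (real_cond_exp P ?G (Y i t) \<omega>) \<omega>) \<partial>P)"
  proof (rule nn_integral_cond_exp_concave[OF P.prob_space_axioms Q.prob_space_axioms R.prob_space_axioms
        G F natural_filtration_subset_obs_total mixture _ _ _ _ k_meas _ k_concave B])
    show "Y i t \<in> borel_measurable ?F" using t by (rule measurable_obs_total)
    show "0 \<le> k c \<omega>" for c \<omega> unfolding k_def using g(2) clip_vec_in_cube by blast
  qed (use a P.Y_bounds[OF t] in auto)
  moreover have "AE \<omega> in Q. QP t \<omega> = clip_vec (\<chi> j. if j = i then real_cond_exp Q ?G (Y i t) \<omega> else \<phi> j \<omega>)"
    unfolding \<phi>_def using Q.Post_eq[OF P.obs_model_axioms sets(1)[symmetric] t other(1)[symmetric], of i] by simp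
  then have "(\<integral>\<^sup>+\<omega>. indicator B \<omega> * ennreal (k (real_cond_exp Q ?G (Y i t) \<omega>) \<omega>) \<partial>Q) =
      (\<integral>\<^sup>+\<omega>. indicator B \<omega> * ennreal (g (QP t \<omega>)) \<partial>Q)"
    unfolding k_def by (intro nn_integral_cong_AE) auto
  moreover have "AE \<omega> in R. RP t \<omega> = clip_vec (\<chi> j. if j = i then real_cond_exp R ?G (Y i t) \<omega> else \<phi> j \<omega>)"
    unfolding \<phi>_def using R.Post_eq[OF P.obs_model_axioms sets(2)[symmetric] t other(2)[symmetric], of i] by simp
  then have "(\<integral>\<^sup>+\<omega>. indicator B \<omega> * ennreal (k (real_cond_exp R ?G (Y i t) \<omega>) \<omega>) \<partial>R) =
      (\<integral>\<^sup>+\<omega>. indicator B \<omega> * ennreal (g (RP t \<omega>)) \<partial>R)"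
    unfolding k_def by (intro nn_integral_cong_AE) auto
  moreover have "AE \<omega> in P. PP t \<omega> = clip_vec (\<chi> j. if j = i then real_cond_exp P ?G (Y i t) \<omega> else \<phi> j \<omega>)"
    unfolding \<phi>_def using P.Post_eq[OF P.obs_model_axioms refl t refl, of i] by simp
  then have "(\<integral>\<^sup>+\<omega>. indicator B \<omega> * ennreal (k (real_cond_exp P ?G (Y i t) \<omega>) \<omega>) \<partial>P) =
      (\<integral>\<^sup>+\<omega>. indicator B \<omega> * ennreal (g (PP t \<omega>)) \<partial>P)"
    unfolding k_def by (intro nn_integral_cong_AE) auto
  ultimately show ?thesis by simp
qed

end

section \<open>Stopped costs\<close>

lemma filtration_natural: "filtration \<Omega> (natural_filtration \<Omega> Z)"
proof
  fix s t :: ennreal assume "s \<le> t"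
  then show "sets (natural_filtration \<Omega> Z s) \<subseteq> sets (natural_filtration \<Omega> Z t)"
    by (intro sets_natural_filtration_subset) (auto intro: measurable_natural_filtration)
qed simp

lemma unit_cube_eq_cbox: "unit_cube = cbox 0 (1 :: real^'n::finite)"
  by (auto simp: unit_cube_def mem_box_cart)

lemma grid_tendsto:
  fixes f :: "real \<Rightarrow> 'b::t2_space" and s :: real
  assumes "continuous_on {0..} f" "0 \<le> s"
  shows "(\<lambda>k. f (real (nat \<lceil>s * Suc k\<rceil>) / Suc k)) \<longlonglongrightarrow> f s"
proof (rule tendsto_right_discretisation[OF assms(2)])
  have "continuous (at s within {0..}) f"
    using assms by (simp add: continuous_on_eq_continuous_within)
  then show "continuous (at_right s) f"
    by (rule continuous_within_subset) (use assms(2) in auto)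
qed

text \<open>The event that \<open>\<tau>\<close>, rounded up to the grid of mesh
  \<open>1 / Suc k\<close>, equals its \<open>m\<close>-th point. At \<open>m = 0\<close> truncated
  subtraction gives \<open>m - 1 = 0\<close>, and without the separate disjunct the cell would be
  empty instead of containing the points with \<open>\<tau> = 0\<close>.\<close>

definition stop_cell :: "'a set \<Rightarrow> ('a \<Rightarrow> ennreal) \<Rightarrow> nat \<Rightarrow> nat \<Rightarrow> 'a set" where
  "stop_cell \<Omega> \<tau> k m = {\<omega>\<in>\<Omega>. \<tau> \<omega> \<le> ennreal (real m / Suc k) \<and>
     (m = 0 \<or> \<not> \<tau> \<omega> \<le> ennreal (real (m - 1) / Suc k))}"

lemma stop_cell_measurable:
  assumes "stopping_time (natural_filtration \<Omega> Z) \<tau>"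
  shows "stop_cell \<Omega> \<tau> k m \<in> sets (natural_filtration \<Omega> Z (ennreal (real m / Suc k)))"
proof -
  interpret filtration \<Omega> "natural_filtration \<Omega> Z" by (rule filtration_natural)
  have "Measurable.pred (natural_filtration \<Omega> Z (ennreal (real m / Suc k)))
      (\<lambda>\<omega>. \<tau> \<omega> \<le> ennreal (real m / Suc k) \<and> (m = 0 \<or> \<not> \<tau> \<omega> \<le> ennreal (real (m - 1) / Suc k)))"
    by (intro pred_intros_logic stopping_time_le_const[OF assms] ennreal_leI divide_right_mono) auto
  then show ?thesis by (simp add: stop_cell_def pred_def)
qed

text \<open>Finiteness matters here: at infinity \<open>enn2real\<close> returns \<open>0\<close>,
  while no cell contains the point.\<close>

lemma stop_cell_iff:
  assumes "\<omega> \<in> \<Omega>" "\<tau> \<omega> < \<infinity>"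
  shows "\<omega> \<in> stop_cell \<Omega> \<tau> k m \<longleftrightarrow> m = nat \<lceil>enn2real (\<tau> \<omega>) * Suc k\<rceil>"
proof -
  obtain r where r: "\<tau> \<omega> = ennreal r" "0 \<le> r" using assms(2) by (cases "\<tau> \<omega>") auto
  have le: "\<tau> \<omega> \<le> ennreal (real l / Suc k) \<longleftrightarrow> r * Suc k \<le> real l" for l
    by (simp add: r ennreal_le_iff pos_le_divide_eq)
  have "0 \<le> r * Suc k" using r(2) by simp
  then have "(r * Suc k \<le> real m \<and> (m = 0 \<or> \<not> r * Suc k \<le> real (m - 1))) \<longleftrightarrow> m = nat \<lceil>r * Suc k\<rceil>"
    by (cases m) (auto simp: nat_eq_iff2 ceiling_eq_iff of_nat_diff simp del: of_nat_Suc)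
  moreover have "enn2real (\<tau> \<omega>) = r" using r by simp
  ultimately show ?thesis using assms(1) by (simp only: stop_cell_def mem_Collect_eq le simp_thms)
qed

context observed_posterior begin

text \<open>The bound holds almost surely at all grid times simultaneously, as these are countably
  many; continuity and closedness of the cube give every other time.\<close>

lemma Post_in_cube_all: "AE \<omega> in M. \<forall>t\<ge>0. Post t \<omega> \<in> unit_cube"
proof -
  have "AE \<omega> in M. \<forall>k m. Post (real m / Suc k) \<omega> \<in> unit_cube"
    by (intro AE_all_countable[THEN iffD2] allI Post_in_cube) simp
  with Post_continuous show ?thesis
  proof eventually_elim
    case (elim \<omega>)
    show ?case
    proof (intro allI impI)
      fix t :: real assume "0 \<le> t"
      with elim(1) have "(\<lambda>k. Post (real (nat \<lceil>t * Suc k\<rceil>) / Suc k) \<omega>) \<longlonglongrightarrow> Post t \<omega>"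
        by (rule grid_tendsto)
      then show "Post t \<omega> \<in> unit_cube"
        by (rule Lim_in_closed_set[rotated 3]) (use elim(2) in \<open>auto simp: unit_cube_eq_cbox closed_cbox\<close>)
    qed
  qed
qed

lemma cost_path_limit:
  fixes g :: "real^'n \<Rightarrow> real"
  assumes g: "continuous_on unit_cube g"
  shows "AE \<omega> in M. \<forall>s\<ge>0::real. (\<lambda>k. g (clip_vec (Post (real (nat \<lceil>s * Suc k\<rceil>) / Suc k) \<omega>))) \<longlonglongrightarrow> g (Post s \<omega>)"
  using Post_continuous Post_in_cube_all
proof eventually_elim
  case (elim \<omega>)
  have "continuous_on {0..} (\<lambda>t. g (clip_vec (Post t \<omega>)))"
    by (rule continuous_on_compose2[OF continuous_clip_vec_compose[OF g] elim(1)]) simp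
  then have "(\<lambda>k. g (clip_vec (Post (real (nat \<lceil>s * Suc k\<rceil>) / Suc k) \<omega>))) \<longlonglongrightarrow> g (clip_vec (Post s \<omega>))"
    if "0 \<le> s" for s :: real using that by (rule grid_tendsto)
  then show ?case using elim(2) by (simp add: clip_vec_id)
qed

lemma measurable_stopping:
  assumes "stopping_time (natural_filtration (space M) X) \<tau>"
  shows "\<tau> \<in> borel_measurable M"
  using subalgebra_natural by (intro measurable_stopping_time[OF assms]) (auto simp: subalgebra_def)

text \<open>The cost at the rounded time converges along continuous paths, dominated by the maximum
  of \<open>g\<close> on the compact cube. The last two facts provide a measurable substitute for
  the stopped cost: continuity of \<open>Post\<close> is only almost sure, so measurability of its
  value at \<open>\<tau>\<close> is not immediate.\<close>

lemma terminal_cost_tendsto: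
  fixes g :: "real^'n \<Rightarrow> real"
  assumes g: "continuous_on unit_cube g" "\<forall>v\<in>unit_cube. 0 \<le> g v"
    and \<tau>: "stopping_time (natural_filtration (space M) X) \<tau>" "AE \<omega> in M. \<tau> \<omega> < \<infinity>"
  shows "(\<lambda>k. \<Sum>m. \<integral>\<^sup>+\<omega>. indicator (stop_cell (space M) \<tau> k m) \<omega> * ennreal (g (Post (real m / Suc k) \<omega>)) \<partial>M)
    \<longlonglongrightarrow> (\<integral>\<^sup>+\<omega>. ennreal (g (Post (enn2real (\<tau> \<omega>)) \<omega>)) \<partial>M)"
    and "(\<lambda>\<omega>. ennreal (lim (\<lambda>k. g (clip_vec (Post (real (nat \<lceil>enn2real (\<tau> \<omega>) * Suc k\<rceil>) / Suc k) \<omega>)))))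
      \<in> borel_measurable M"
    and "AE \<omega> in M. ennreal (lim (\<lambda>k. g (clip_vec (Post (real (nat \<lceil>enn2real (\<tau> \<omega>) * Suc k\<rceil>) / Suc k) \<omega>)))) =
      ennreal (g (Post (enn2real (\<tau> \<omega>)) \<omega>))"
proof -
  have [measurable]: "\<tau> \<in> borel_measurable M" using \<tau>(1) by (rule measurable_stopping)
  have gm: "(\<lambda>\<omega>. g (clip_vec (Post (real m / Suc k) \<omega>))) \<in> borel_measurable M" for m k
    by (rule measurable_clip_vec_compose[OF g(1) measurable_Post]) simp
  define v where "v k \<omega> = g (clip_vec (Post (real (nat \<lceil>enn2real (\<tau> \<omega>) * Suc k\<rceil>) / Suc k) \<omega>))" for k \<omega>
  have vm: "v k \<in> borel_measurable M" for k
    unfolding v_def[abs_def]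
    by (rule measurable_compose_countable[where g="\<lambda>\<omega>. nat \<lceil>enn2real (\<tau> \<omega>) * Suc k\<rceil>", OF gm]) measurable
  show lim_meas: "(\<lambda>\<omega>. ennreal (lim (\<lambda>k. g (clip_vec (Post (real (nat \<lceil>enn2real (\<tau> \<omega>) * Suc k\<rceil>) / Suc k) \<omega>)))))
      \<in> borel_measurable M"
    using borel_measurable_lim_metric[OF vm] unfolding v_def by measurable
  have conv: "AE \<omega> in M. (\<lambda>k. v k \<omega>) \<longlonglongrightarrow> g (Post (enn2real (\<tau> \<omega>)) \<omega>)"
    using cost_path_limit[OF g(1)] by eventually_elim (simp add: v_def)
  then show lim_eq: "AE \<omega> in M. ennreal (lim (\<lambda>k. g (clip_vec (Post (real (nat \<lceil>enn2real (\<tau> \<omega>) * Suc k\<rceil>) / Suc k) \<omega>)))) =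
      ennreal (g (Post (enn2real (\<tau> \<omega>)) \<omega>))"
    unfolding v_def[symmetric] by eventually_elim (simp add: limI)
  have "compact (unit_cube :: (real^'n) set)" by (simp add: unit_cube_eq_cbox compact_cbox)
  moreover have "(unit_cube :: (real^'n) set) \<noteq> {}" using clip_vec_in_cube by blast
  ultimately obtain v0 where v0: "v0 \<in> unit_cube" "\<And>v. v \<in> unit_cube \<Longrightarrow> g v \<le> g v0"
    using continuous_attains_sup[OF _ _ g(1)] by metis
  have "(\<lambda>k. \<integral>\<^sup>+\<omega>. ennreal (v k \<omega>) \<partial>M) \<longlonglongrightarrow> (\<integral>\<^sup>+\<omega>. ennreal (lim (\<lambda>k. v k \<omega>)) \<partial>M)"
  proof (rule nn_integral_dominated_convergence[where w="\<lambda>_. ennreal (g v0)"])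
    show "(\<lambda>\<omega>. ennreal (v k \<omega>)) \<in> borel_measurable M" for k using vm by measurable
    show "(\<lambda>\<omega>. ennreal (lim (\<lambda>k. v k \<omega>))) \<in> borel_measurable M" using lim_meas unfolding v_def .
    show "AE \<omega> in M. ennreal (v k \<omega>) \<le> ennreal (g v0)" for k
      unfolding v_def using v0(2) clip_vec_in_cube by (intro AE_I2 ennreal_leI) blast
    show "(\<integral>\<^sup>+\<omega>. ennreal (g v0) \<partial>M) < \<infinity>" by (simp add: emeasure_space_1)
    show "AE \<omega> in M. (\<lambda>k. ennreal (v k \<omega>)) \<longlonglongrightarrow> ennreal (lim (\<lambda>k. v k \<omega>))"
      using conv by eventually_elim (simp add: limI tendsto_ennrealI)
  qed simp
  also have "(\<integral>\<^sup>+\<omega>. ennreal (lim (\<lambda>k. v k \<omega>)) \<partial>M) = (\<integral>\<^sup>+\<omega>. ennreal (g (Post (enn2real (\<tau> \<omega>)) \<omega>)) \<partial>M)"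
    using lim_eq unfolding v_def by (rule nn_integral_cong_AE)
  also have "(\<lambda>k. \<integral>\<^sup>+\<omega>. ennreal (v k \<omega>) \<partial>M) =
    (\<lambda>k. \<Sum>m. \<integral>\<^sup>+\<omega>. indicator (stop_cell (space M) \<tau> k m) \<omega> * ennreal (g (Post (real m / Suc k) \<omega>)) \<partial>M)"
  proof
    fix k
    let ?c = "\<lambda>m \<omega>. indicator (stop_cell (space M) \<tau> k m) \<omega> * ennreal (g (clip_vec (Post (real m / Suc k) \<omega>)))"
    have cell: "stop_cell (space M) \<tau> k m \<in> sets M" for m
      using stop_cell_measurable[OF \<tau>(1)] subalgebra_natural unfolding subalgebra_def by blast
    have "(\<integral>\<^sup>+\<omega>. ennreal (v k \<omega>) \<partial>M) = (\<integral>\<^sup>+\<omega>. (\<Sum>m. ?c m \<omega>) \<partial>M)"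
    proof (rule nn_integral_cong_AE)
      show "AE \<omega> in M. ennreal (v k \<omega>) = (\<Sum>m. ?c m \<omega>)"
        using \<tau>(2) AE_space
      proof eventually_elim
        case (elim \<omega>)
        let ?n = "nat \<lceil>enn2real (\<tau> \<omega>) * Suc k\<rceil>"
        \<comment> \<open>For fixed \<open>k\<close> a point with finite \<open>\<tau>\<close> lies
          in exactly one cell, so the series has one nonzero term.\<close>
        have "(\<Sum>m. ?c m \<omega>) = (\<Sum>m\<in>{?n}. ?c m \<omega>)"
          by (rule suminf_finite) (use elim in \<open>auto simp: stop_cell_iff indicator_def\<close>)
        also have "\<dots> = ennreal (v k \<omega>)"
          using elim stop_cell_iff[of \<omega> "space M" \<tau> k ?n] by (simp add: v_def)
        finally show ?case ..
      qed
    qed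
    also have "\<dots> = (\<Sum>m. \<integral>\<^sup>+\<omega>. ?c m \<omega> \<partial>M)"
      by (intro nn_integral_suminf borel_measurable_times_ennreal borel_measurable_indicator cell
          measurable_compose[OF gm measurable_ennreal])
    also have "\<dots> = (\<Sum>m. \<integral>\<^sup>+\<omega>. indicator (stop_cell (space M) \<tau> k m) \<omega> * ennreal (g (Post (real m / Suc k) \<omega>)) \<partial>M)"
    proof (intro suminf_cong nn_integral_cong_AE)
      fix m
      have "AE \<omega> in M. Post (real m / Suc k) \<omega> \<in> unit_cube" by (rule Post_in_cube) simp
      then show "AE \<omega> in M. ?c m \<omega> = indicator (stop_cell (space M) \<tau> k m) \<omega> * ennreal (g (Post (real m / Suc k) \<omega>))"
        by eventually_elim (simp add: clip_vec_id)
    qed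
    finally show "(\<integral>\<^sup>+\<omega>. ennreal (v k \<omega>) \<partial>M) =
      (\<Sum>m. \<integral>\<^sup>+\<omega>. indicator (stop_cell (space M) \<tau> k m) \<omega> * ennreal (g (Post (real m / Suc k) \<omega>)) \<partial>M)" .
  qed
  finally show "(\<lambda>k. \<Sum>m. \<integral>\<^sup>+\<omega>. indicator (stop_cell (space M) \<tau> k m) \<omega> * ennreal (g (Post (real m / Suc k) \<omega>)) \<partial>M)
    \<longlonglongrightarrow> (\<integral>\<^sup>+\<omega>. ennreal (g (Post (enn2real (\<tau> \<omega>)) \<omega>)) \<partial>M)" .
qed

text \<open>The inner integral left after exchanging time and expectation in the running cost. The
  outer indicator restricts Lebesgue measure on the whole line to nonnegative times.\<close>

definition running_rate :: "(real^'n \<Rightarrow> real) \<Rightarrow> ('a \<Rightarrow> ennreal) \<Rightarrow> real \<Rightarrow> ennreal" where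
  "running_rate h \<tau> s = indicator {0..} s *
     (\<integral>\<^sup>+\<omega>. indicator {\<omega>\<in>space M. ennreal s \<le> \<tau> \<omega>} \<omega> * ennreal (h (Post s \<omega>)) \<partial>M)"

text \<open>Tonelli's theorem requires joint measurability, which \<open>Post\<close> has only after
  modification; the cost is therefore first replaced by an almost surely equal measurable
  version.\<close>

lemma expected_cost_eq:
  fixes g h :: "real^'n \<Rightarrow> real"
  assumes g: "continuous_on unit_cube g" "\<forall>v\<in>unit_cube. 0 \<le> g v"
    and h: "continuous_on unit_cube h"
    and \<tau>: "stopping_time (natural_filtration (space M) X) \<tau>" "AE \<omega> in M. \<tau> \<omega> < \<infinity>"
  shows "expected_cost M Post g h \<tau> =
      (\<integral>\<^sup>+\<omega>. ennreal (g (Post (enn2real (\<tau> \<omega>)) \<omega>)) \<partial>M) + (\<integral>\<^sup>+s. running_rate h \<tau> s \<partial>lborel)"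
    and "running_rate h \<tau> \<in> borel_measurable lborel"
proof -
  interpret pair_sigma_finite M lborel ..
  have \<tau>m[measurable]: "\<tau> \<in> borel_measurable M" using \<tau>(1) by (rule measurable_stopping)
  \<comment> \<open>Limits of grid values give a jointly measurable process that almost surely
    equals \<open>h (Post s \<omega>)\<close> for all \<open>s \<ge> 0\<close> at once.\<close>
  define H where "H \<omega> s = lim (\<lambda>k. h (clip_vec (Post (real (nat \<lceil>s * Suc k\<rceil>) / Suc k) \<omega>)))" for \<omega> and s :: real
  have Hm: "case_prod H \<in> borel_measurable (M \<Otimes>\<^sub>M lborel)"
    unfolding H_def
    using measurable_right_discretisation[of "\<lambda>t \<omega>. h (clip_vec (Post t \<omega>))" M]
      measurable_clip_vec_compose[OF h measurable_Post] by simp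
  have HA: "AE \<omega> in M. \<forall>s\<ge>0. H \<omega> s = h (Post s \<omega>)"
    using cost_path_limit[OF h] by eventually_elim (simp add: H_def limI)
  define K where "K \<omega> s = ennreal (H \<omega> s) * indicator {s. 0 \<le> s \<and> ennreal s \<le> \<tau> \<omega>} s" for \<omega> s
  have "{x \<in> space (M \<Otimes>\<^sub>M lborel). 0 \<le> snd x \<and> ennreal (snd x) \<le> \<tau> (fst x)} \<in> sets (M \<Otimes>\<^sub>M lborel)"
    by measurable
  then have "(\<lambda>x. indicator {x \<in> space (M \<Otimes>\<^sub>M lborel). 0 \<le> snd x \<and> ennreal (snd x) \<le> \<tau> (fst x)} x :: ennreal)
      \<in> borel_measurable (M \<Otimes>\<^sub>M lborel)"
    by (rule borel_measurable_indicator)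
  then have "(\<lambda>x. ennreal (case_prod H x) *
      indicator {x \<in> space (M \<Otimes>\<^sub>M lborel). 0 \<le> snd x \<and> ennreal (snd x) \<le> \<tau> (fst x)} x)
      \<in> borel_measurable (M \<Otimes>\<^sub>M lborel)"
    using Hm by (intro borel_measurable_times_ennreal measurable_compose[OF Hm measurable_ennreal])
  moreover have "ennreal (case_prod H x) *
      indicator {x \<in> space (M \<Otimes>\<^sub>M lborel). 0 \<le> snd x \<and> ennreal (snd x) \<le> \<tau> (fst x)} x = case_prod K x"
    if "x \<in> space (M \<Otimes>\<^sub>M lborel)" for x
    using that by (auto simp: K_def indicator_def split: prod.splits)
  ultimately have Km: "case_prod K \<in> borel_measurable (M \<Otimes>\<^sub>M lborel)"
    by (subst measurable_cong[symmetric]) auto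
  let ?G = "\<lambda>\<omega>. ennreal (lim (\<lambda>k. g (clip_vec (Post (real (nat \<lceil>enn2real (\<tau> \<omega>) * Suc k\<rceil>) / Suc k) \<omega>))))"
  note Gm = terminal_cost_tendsto(2)[OF g \<tau>] and GA = terminal_cost_tendsto(3)[OF g \<tau>]
  have rate: "(\<integral>\<^sup>+\<omega>. K \<omega> s \<partial>M) = running_rate h \<tau> s" for s
  proof (cases "0 \<le> s")
    case True
    have "(\<integral>\<^sup>+\<omega>. K \<omega> s \<partial>M) =
      (\<integral>\<^sup>+\<omega>. indicator {\<omega>\<in>space M. ennreal s \<le> \<tau> \<omega>} \<omega> * ennreal (h (Post s \<omega>)) \<partial>M)"
    proof (rule nn_integral_cong_AE)
      show "AE \<omega> in M. K \<omega> s = indicator {\<omega>\<in>space M. ennreal s \<le> \<tau> \<omega>} \<omega> * ennreal (h (Post s \<omega>))"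
        using HA AE_space by eventually_elim (simp add: K_def True indicator_def)
    qed
    then show ?thesis using True by (simp add: running_rate_def)
  next
    case False
    then show ?thesis by (simp add: K_def running_rate_def)
  qed
  have "(\<lambda>s. \<integral>\<^sup>+\<omega>. K \<omega> s \<partial>M) \<in> borel_measurable lborel"
  proof (rule sigma_finite_measure.borel_measurable_nn_integral[OF prob_space_imp_sigma_finite[OF prob_space_axioms]])
    show "(\<lambda>(s, \<omega>). K \<omega> s) \<in> borel_measurable (lborel \<Otimes>\<^sub>M M)"
      using measurable_pair_swap[OF Km] by simp
  qed
  then show "running_rate h \<tau> \<in> borel_measurable lborel" by (simp add: rate)
  have "expected_cost M Post g h \<tau> = (\<integral>\<^sup>+\<omega>. (?G \<omega> + (\<integral>\<^sup>+s. K \<omega> s \<partial>lborel)) \<partial>M)"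
    unfolding expected_cost_def
  proof (rule nn_integral_cong_AE)
    show "AE \<omega> in M. ennreal (g (Post (enn2real (\<tau> \<omega>)) \<omega>)) +
        (\<integral>\<^sup>+s\<in>{s. 0 \<le> s \<and> ennreal s \<le> \<tau> \<omega>}. ennreal (h (Post s \<omega>)) \<partial>lborel) =
        ?G \<omega> + (\<integral>\<^sup>+s. K \<omega> s \<partial>lborel)"
      using GA HA
    proof eventually_elim
      case (elim \<omega>)
      have "(\<integral>\<^sup>+s\<in>{s. 0 \<le> s \<and> ennreal s \<le> \<tau> \<omega>}. ennreal (h (Post s \<omega>)) \<partial>lborel) = (\<integral>\<^sup>+s. K \<omega> s \<partial>lborel)"
        using elim(2) by (intro nn_integral_cong) (simp add: K_def split: split_indicator)
      then show ?case using elim(1) by simp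
    qed
  qed
  also have "\<dots> = (\<integral>\<^sup>+\<omega>. ?G \<omega> \<partial>M) + (\<integral>\<^sup>+\<omega>. (\<integral>\<^sup>+s. K \<omega> s \<partial>lborel) \<partial>M)"
    using Gm lborel.borel_measurable_nn_integral[OF Km] by (rule nn_integral_add)
  also have "(\<integral>\<^sup>+\<omega>. (\<integral>\<^sup>+s. K \<omega> s \<partial>lborel) \<partial>M) = (\<integral>\<^sup>+s. (\<integral>\<^sup>+\<omega>. K \<omega> s \<partial>M) \<partial>lborel)"
    using Km by (rule Fubini'[symmetric])
  also have "\<dots> = (\<integral>\<^sup>+s. running_rate h \<tau> s \<partial>lborel)" by (simp add: rate)
  also have "(\<integral>\<^sup>+\<omega>. ?G \<omega> \<partial>M) = (\<integral>\<^sup>+\<omega>. ennreal (g (Post (enn2real (\<tau> \<omega>)) \<omega>)) \<partial>M)"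
    using GA by (rule nn_integral_cong_AE)
  finally show "expected_cost M Post g h \<tau> =
      (\<integral>\<^sup>+\<omega>. ennreal (g (Post (enn2real (\<tau> \<omega>)) \<omega>)) \<partial>M) + (\<integral>\<^sup>+s. running_rate h \<tau> s \<partial>lborel)" .
qed

end

context mixed_posteriors begin

text \<open>The event of never stopping belongs to \<open>obs_total\<close>, where the mixture
  identity holds. It is null for \<open>P\<close>, and both weights are positive.\<close>

lemma finite_transfer:
  assumes \<tau>: "stopping_time (natural_filtration (space P) X) \<tau>" and fin: "AE \<omega> in P. \<tau> \<omega> < \<infinity>"
  shows "AE \<omega> in Q. \<tau> \<omega> < \<infinity>" "AE \<omega> in R. \<tau> \<omega> < \<infinity>"
proof -
  let ?F = "obs_total Y X (space P)"
  have "\<tau> \<in> borel_measurable ?F"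
    by (rule measurable_stopping_time[OF \<tau> natural_filtration_subset_obs_total]) simp
  then have N: "{\<omega>\<in>space P. \<not> \<tau> \<omega> < \<infinity>} \<in> sets ?F" (is "?N \<in> _")
  proof -
    have "?N = \<tau> -` {\<infinity>} \<inter> space ?F" by (auto simp: less_top[symmetric])
    then show ?thesis using measurable_sets[OF \<open>\<tau> \<in> borel_measurable ?F\<close>, of "{\<infinity>}"] by simp
  qed
  have NP: "?N \<in> sets P" using N P.obs_total_subset by blast
  have "measure P ?N = 0"
    using fin AE_iff_measurable[OF NP refl] by (simp add: measure_def)
  then have "(1 - a) * measure Q ?N + a * measure R ?N = 0"
    using mixture_onD[OF mixture N] by simp
  then have "measure Q ?N = 0" "measure R ?N = 0"
    using a by (auto simp: add_nonneg_eq_0_iff)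
  then show "AE \<omega> in Q. \<tau> \<omega> < \<infinity>" "AE \<omega> in R. \<tau> \<omega> < \<infinity>"
    using NP sets spaces
    by (auto simp: AE_iff_measurable[of ?N] Q.emeasure_eq_measure R.emeasure_eq_measure)
qed

lemma expected_cost_concave:
  assumes g: "continuous_on unit_cube g" "\<forall>v\<in>unit_cube. 0 \<le> g v" "concave_in_each_variable g"
    and h: "continuous_on unit_cube h" "\<forall>v\<in>unit_cube. 0 \<le> h v" "concave_in_each_variable h"
    and \<tau>: "stopping_time (natural_filtration (space P) X) \<tau>" and fin: "AE \<omega> in P. \<tau> \<omega> < \<infinity>"
  shows "ennreal (1 - a) * expected_cost Q QP g h \<tau> + ennreal a * expected_cost R RP g h \<tau> \<le>
    expected_cost P PP g h \<tau>"
proof -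
  interpret filtration "space P" "natural_filtration (space P) X" by (rule filtration_natural)
  let ?b = "ennreal (1 - a)" and ?a = "ennreal a"
  note finQ = finite_transfer(1)[OF \<tau> fin] and finR = finite_transfer(2)[OF \<tau> fin]
  have \<tau>Q: "stopping_time (natural_filtration (space Q) X) \<tau>"
    and \<tau>R: "stopping_time (natural_filtration (space R) X) \<tau>" using \<tau> spaces by simp_all
  let ?T = "\<lambda>N Post. \<integral>\<^sup>+\<omega>. ennreal (g (Post (enn2real (\<tau> \<omega>)) \<omega>)) \<partial>N"
  let ?S = "\<lambda>N Post k. \<Sum>m. \<integral>\<^sup>+\<omega>. indicator (stop_cell (space P) \<tau> k m) \<omega> * ennreal (g (Post (real m / Suc k) \<omega>)) \<partial>N"
  have limP: "?S P PP \<longlonglongrightarrow> ?T P PP" by (rule P.terminal_cost_tendsto(1)[OF g(1,2) \<tau> fin])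
  have limQ: "?S Q QP \<longlonglongrightarrow> ?T Q QP"
    using Q.terminal_cost_tendsto(1)[OF g(1,2) \<tau>Q finQ] spaces by simp
  have limR: "?S R RP \<longlonglongrightarrow> ?T R RP"
    using R.terminal_cost_tendsto(1)[OF g(1,2) \<tau>R finR] spaces by simp
  have terminal: "?b * ?T Q QP + ?a * ?T R RP \<le> ?T P PP"
  proof (rule LIMSEQ_le[OF _ limP])
    show "(\<lambda>k. ?b * ?S Q QP k + ?a * ?S R RP k) \<longlonglongrightarrow> ?b * ?T Q QP + ?a * ?T R RP"
      by (intro tendsto_add ennreal_tendsto_cmult limQ limR) auto
    show "\<exists>N. \<forall>k\<ge>N. ?b * ?S Q QP k + ?a * ?S R RP k \<le> ?S P PP k"
    proof (intro exI allI impI)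
      fix k
      have "?b * ?S Q QP k + ?a * ?S R RP k = (\<Sum>m.
        ?b * (\<integral>\<^sup>+\<omega>. indicator (stop_cell (space P) \<tau> k m) \<omega> * ennreal (g (QP (real m / Suc k) \<omega>)) \<partial>Q) +
        ?a * (\<integral>\<^sup>+\<omega>. indicator (stop_cell (space P) \<tau> k m) \<omega> * ennreal (g (RP (real m / Suc k) \<omega>)) \<partial>R))"
        unfolding ennreal_suminf_cmult[symmetric] by (rule suminf_add) auto
      also have "\<dots> \<le> ?S P PP k"
        \<comment> \<open>On the \<open>m\<close>-th cell the rounded time is deterministic and the
          cell is observable by then, so the inequality at a fixed time applies to each
          term.\<close>
        by (intro suminf_le fixed_time_concave[OF g] stop_cell_measurable[OF \<tau>]) auto
      finally show "?b * ?S Q QP k + ?a * ?S R RP k \<le> ?S P PP k" .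
    qed
  qed
  have "?b * (\<integral>\<^sup>+s. Q.running_rate h \<tau> s \<partial>lborel) + ?a * (\<integral>\<^sup>+s. R.running_rate h \<tau> s \<partial>lborel) =
    (\<integral>\<^sup>+s. ?b * Q.running_rate h \<tau> s + ?a * R.running_rate h \<tau> s \<partial>lborel)"
    using Q.expected_cost_eq(2)[OF g(1,2) h(1) \<tau>Q finQ] R.expected_cost_eq(2)[OF g(1,2) h(1) \<tau>R finR]
    by (simp add: nn_integral_add nn_integral_cmult)
  also have "\<dots> \<le> (\<integral>\<^sup>+s. P.running_rate h \<tau> s \<partial>lborel)"
  proof (rule nn_integral_mono)
    fix s
    show "?b * Q.running_rate h \<tau> s + ?a * R.running_rate h \<tau> s \<le> P.running_rate h \<tau> s"
    proof (cases "0 \<le> s")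
      case True
      \<comment> \<open>The complement of \<open>\<tau> < s\<close>, which is observable at time
        \<open>s\<close>.\<close>
      have "{\<omega>\<in>space P. ennreal s \<le> \<tau> \<omega>} \<in> sets (natural_filtration (space P) X (ennreal s))"
        using pred_intros_logic(2)[OF stopping_time_less_const[OF \<tau>, of "ennreal s"]] by (simp add: pred_def not_less)
      from fixed_time_concave[OF h True this] show ?thesis
        using True by (simp add: P.running_rate_def Q.running_rate_def R.running_rate_def spaces)
    next
      case False
      then show ?thesis by (simp add: P.running_rate_def Q.running_rate_def R.running_rate_def)
    qed
  qed
  finally have running: "?b * (\<integral>\<^sup>+s. Q.running_rate h \<tau> s \<partial>lborel) + ?a * (\<integral>\<^sup>+s. R.running_rate h \<tau> s \<partial>lborel) \<le>
    (\<integral>\<^sup>+s. P.running_rate h \<tau> s \<partial>lborel)" .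
  note costs = P.expected_cost_eq(1)[OF g(1,2) h(1) \<tau> fin]
    Q.expected_cost_eq(1)[OF g(1,2) h(1) \<tau>Q finQ] R.expected_cost_eq(1)[OF g(1,2) h(1) \<tau>R finR]
  have "?b * expected_cost Q QP g h \<tau> + ?a * expected_cost R RP g h \<tau> =
    (?b * ?T Q QP + ?a * ?T R RP) +
    (?b * (\<integral>\<^sup>+s. Q.running_rate h \<tau> s \<partial>lborel) + ?a * (\<integral>\<^sup>+s. R.running_rate h \<tau> s \<partial>lborel))"
    unfolding costs by (simp add: distrib_left ac_simps)
  also have "\<dots> \<le> expected_cost P PP g h \<tau>"
    unfolding costs using terminal running by (rule add_mono)
  finally show ?thesis .
qed

end

section \<open>From expected costs to the value function\<close>

text \<open>Stopping at once costs at most the maximum of \<open>g\<close> on the cube. This bounds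
  the value function and permits the passage to real numbers.\<close>

lemma (in observed_posterior) expected_cost_zero_finite:
  fixes g h :: "real^'n \<Rightarrow> real"
  assumes g: "continuous_on unit_cube g"
  shows "expected_cost M Post g h (\<lambda>_. 0) < \<infinity>"
proof -
  have "compact (unit_cube :: (real^'n) set)" by (simp add: unit_cube_eq_cbox compact_cbox)
  moreover have "(unit_cube :: (real^'n) set) \<noteq> {}" using clip_vec_in_cube by blast
  ultimately obtain v0 where v0: "\<And>v. v \<in> unit_cube \<Longrightarrow> g v \<le> g v0"
    using continuous_attains_sup[OF _ _ g] by metis
  \<comment> \<open>The domain of integration is the single point \<open>0\<close>, a Lebesgue null
    set.\<close>
  have run: "(\<integral>\<^sup>+s\<in>{s. 0 \<le> s \<and> ennreal s \<le> 0}. ennreal (h (Post s \<omega>)) \<partial>lborel) = 0" for \<omega>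
  proof -
    have "AE s in lborel. s \<noteq> (0::real)" by (rule AE_lborel_singleton)
    then have "AE s in lborel. ennreal (h (Post s \<omega>)) * indicator {s. 0 \<le> s \<and> ennreal s \<le> 0} s = 0"
      by eventually_elim (auto simp: indicator_def ennreal_eq_0_iff)
    then show ?thesis by (subst nn_integral_cong_AE[where v="\<lambda>_. 0"]) auto
  qed
  have "expected_cost M Post g h (\<lambda>_. 0) = (\<integral>\<^sup>+\<omega>. ennreal (g (Post 0 \<omega>)) \<partial>M)"
    unfolding expected_cost_def run by simp
  also have "\<dots> \<le> (\<integral>\<^sup>+\<omega>. ennreal (g v0) \<partial>M)"
  proof (rule nn_integral_mono_AE)
    show "AE \<omega> in M. ennreal (g (Post 0 \<omega>)) \<le> ennreal (g v0)"
      using Post_in_cube[OF order_refl] by eventually_elim (intro ennreal_leI v0)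
  qed
  also have "\<dots> < \<infinity>" by (simp add: emeasure_space_1)
  finally show ?thesis .
qed

lemma (in observed_posterior) zero_admissible: "(\<lambda>_. 0) \<in> admissible_times M X"
  by (simp add: admissible_times_def stopping_time_const)

text \<open>Every time admissible under \<open>P\<close> is admissible under \<open>Q\<close> and
  \<open>R\<close>, so its costs there bound the two infima from above. An infimum of concave
  quantities over times is again concave.\<close>

lemma (in mixed_posteriors) optimal_cost_concave:
  assumes g: "continuous_on unit_cube g" "\<forall>v\<in>unit_cube. 0 \<le> g v" "concave_in_each_variable g"
    and h: "continuous_on unit_cube h" "\<forall>v\<in>unit_cube. 0 \<le> h v" "concave_in_each_variable h"
  shows "ennreal (1 - a) * (INF \<tau>\<in>admissible_times Q X. expected_cost Q QP g h \<tau>) +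
      ennreal a * (INF \<tau>\<in>admissible_times R X. expected_cost R RP g h \<tau>) \<le>
    (INF \<tau>\<in>admissible_times P X. expected_cost P PP g h \<tau>)"
proof (rule INF_greatest)
  fix \<tau> assume "\<tau> \<in> admissible_times P X"
  then have \<tau>: "stopping_time (natural_filtration (space P) X) \<tau>" "AE \<omega> in P. \<tau> \<omega> < \<infinity>"
    by (auto simp: admissible_times_def)
  then have "\<tau> \<in> admissible_times Q X" "\<tau> \<in> admissible_times R X"
    using finite_transfer[OF \<tau>] spaces by (auto simp: admissible_times_def)
  then have "ennreal (1 - a) * (INF \<tau>\<in>admissible_times Q X. expected_cost Q QP g h \<tau>) +
      ennreal a * (INF \<tau>\<in>admissible_times R X. expected_cost R RP g h \<tau>) \<le>
    ennreal (1 - a) * expected_cost Q QP g h \<tau> + ennreal a * expected_cost R RP g h \<tau>"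
    by (intro add_mono mult_left_mono INF_lower) auto
  also have "\<dots> \<le> expected_cost P PP g h \<tau>"
    by (rule expected_cost_concave[OF g h \<tau>])
  finally show "ennreal (1 - a) * (INF \<tau>\<in>admissible_times Q X. expected_cost Q QP g h \<tau>) +
      ennreal a * (INF \<tau>\<in>admissible_times R X. expected_cost R RP g h \<tau>) \<le> expected_cost P PP g h \<tau>" .
qed

text \<open>Finiteness accompanies concavity because \<open>enn2real\<close> sends infinity to
  \<open>0\<close>; only with finite values does the real-valued function represent the
  infimum.\<close>

theorem theorem3p4:
  fixes \<mu> lam :: "'n::finite \<Rightarrow> real"
    and M :: "'a measure" and P :: "real^'n \<Rightarrow> 'a measure"
    and Y W :: "'n \<Rightarrow> real \<Rightarrow> 'a \<Rightarrow> real" and X :: "real \<Rightarrow> 'a \<Rightarrow> real^'n"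
    and Post :: "real^'n \<Rightarrow> real \<Rightarrow> 'a \<Rightarrow> real^'n"
    and g h :: "real^'n \<Rightarrow> real"
  assumes mu_pos: "\<And>i. \<mu> i > 0" and lam_nonneg: "\<And>i. lam i \<ge> 0"
    and sets_P: "\<And>\<pi>. \<pi> \<in> unit_cube \<Longrightarrow> sets (P \<pi>) = sets M"
    and model: "\<And>\<pi>. \<pi> \<in> unit_cube \<Longrightarrow> observation_model \<mu> lam \<pi> (P \<pi>) Y W X"
    and posterior: "\<And>\<pi>. \<pi> \<in> unit_cube \<Longrightarrow> posterior_process (P \<pi>) Y X (Post \<pi>)"
    and g_nonneg: "\<And>\<pi>. \<pi> \<in> unit_cube \<Longrightarrow> g \<pi> \<ge> 0"
    and h_nonneg: "\<And>\<pi>. \<pi> \<in> unit_cube \<Longrightarrow> h \<pi> \<ge> 0"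
    and g_lipschitz: "\<exists>L. L-lipschitz_on unit_cube g"
    and h_lipschitz: "\<exists>L. L-lipschitz_on unit_cube h"
    and g_concave: "concave_in_each_variable g"
    and h_concave: "concave_in_each_variable h"
    and h_const: "(\<exists>i. lam i = 0) \<Longrightarrow> \<exists>c. \<forall>\<pi>\<in>unit_cube. h \<pi> = c"
  shows "(\<forall>\<pi>\<in>unit_cube. value_function P X Post g h \<pi> < \<infinity>) \<and>
    concave_in_each_variable (\<lambda>\<pi>. enn2real (value_function P X Post g h \<pi>))"
proof -
  have g_cont: "continuous_on unit_cube g" and h_cont: "continuous_on unit_cube h"
    using g_lipschitz h_lipschitz by (auto intro: lipschitz_on_continuous_on)
  have g_pos: "\<forall>v\<in>unit_cube. 0 \<le> g v" and h_pos: "\<forall>v\<in>unit_cube. 0 \<le> h v"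
    using g_nonneg h_nonneg by auto
  have obs: "observed_posterior \<mu> lam \<pi> (P \<pi>) Y W X (Post \<pi>)" if "\<pi> \<in> unit_cube" for \<pi>
    by (intro observed_posterior.intro obs_model.intro observed_posterior_axioms.intro model posterior that)
  let ?V = "value_function P X Post g h"
  have fin: "?V \<pi> < \<infinity>" if "\<pi> \<in> unit_cube" for \<pi>
  proof -
    interpret observed_posterior \<mu> lam \<pi> "P \<pi>" Y W X "Post \<pi>" by (rule obs[OF that])
    have "?V \<pi> \<le> expected_cost (P \<pi>) (Post \<pi>) g h (\<lambda>_. 0)"
      unfolding value_function_def using zero_admissible by (rule INF_lower)
    also have "\<dots> < \<infinity>" by (rule expected_cost_zero_finite[OF g_cont])
    finally show ?thesis .
  qed
  moreover have "concave_in_each_variable (\<lambda>\<pi>. enn2real (?V \<pi>))"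
    unfolding concave_in_each_variable_def
  proof (intro allI ballI)
    fix i and \<pi> :: "real^'n" assume \<pi>: "\<pi> \<in> unit_cube"
    define q where "q x = (\<chi> j. if j = i then x else \<pi> $ j)" for x
    have q: "q x \<in> unit_cube" if "x \<in> {0..1}" for x
      using \<pi> that by (simp add: unit_cube_def q_def)
    have "concave_on {0..1} (\<lambda>x. enn2real (?V (q x)))"
    \<comment> \<open>This criterion asks only for weights strictly between \<open>0\<close> and
      \<open>1\<close>, the range required by \<open>mixed_posteriors\<close>.\<close>
    proof (rule concave_on_linorderI)
      fix t x y :: real
      assume t: "0 < t" "t < 1" and xy: "x \<in> {0..1}" "y \<in> {0..1}"
      let ?z = "(1 - t) *\<^sub>R x + t *\<^sub>R y"
      have z: "?z \<in> {0..1}"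
        using xy t by (intro convexD[OF convex_real_interval(5)]) auto
      have sets_eq: "sets (P (q x)) = sets (P (q ?z))" "sets (P (q y)) = sets (P (q ?z))"
        using sets_P[OF q[OF xy(1)]] sets_P[OF q[OF xy(2)]] sets_P[OF q[OF z]] by simp_all
      interpret mixed_posteriors \<mu> lam "q ?z" "q x" "q y" "P (q ?z)" "P (q x)" "P (q y)" Y W X
        "Post (q ?z)" "Post (q x)" "Post (q y)" t i
        by (intro mixed_posteriors.intro mixed_posteriors_axioms.intro obs q xy z t sets_eq)
          (auto simp: q_def)
      have le: "ennreal (1 - t) * ?V (q x) + ennreal t * ?V (q y) \<le> ?V (q ?z)"
        unfolding value_function_def
        by (rule optimal_cost_concave[OF g_cont g_pos g_concave h_cont h_pos h_concave])
      obtain u v where uv: "?V (q x) = ennreal u" "0 \<le> u" "?V (q y) = ennreal v" "0 \<le> v"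
        using fin[OF q[OF xy(1)]] fin[OF q[OF xy(2)]] by (cases "?V (q x)"; cases "?V (q y)") auto
      have "ennreal ((1 - t) * u + t * v) \<le> ?V (q ?z)"
        using le t uv by (simp add: ennreal_plus ennreal_mult)
      then have "(1 - t) * u + t * v \<le> enn2real (?V (q ?z))"
        using fin[OF q[OF z]] t uv by (metis enn2real_ennreal enn2real_mono add_nonneg_nonneg
            mult_nonneg_nonneg diff_ge_0_iff_ge less_imp_le infinity_ennreal_def)
      then show "(1 - t) * enn2real (?V (q x)) + t * enn2real (?V (q y)) \<le> enn2real (?V (q ?z))"
        using uv by simp
    qed simp
    then show "concave_on {0..1} (\<lambda>x. enn2real (?V (\<chi> j. if j = i then x else \<pi> $ j)))"
      by (simp add: q_def)
  qed
  ultimately show ?thesis by blast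
qed

end
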